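(* Let $d\ge 3$ and $3\le s\le d$, and let $P$ be a $d$-polytope with $d+s$ vertices and at least $d+3$ facets. Then for each $k\in\{1,\dots,d-2\}$, \[f_k(P)\ge \zeta_k(d+s,d)=\binom{d+1}{k+1}+\binom{d}{k+1}-\binom{d+1-s}{k+1}+\binom{d-1}{k}-\binom{d+1-s}{k}.\]
   Context: $f_k(P)$ denotes the number of $k$-faces of $P$. Binomial coefficients $\binom{n}{j}$ are $0$ when $j<0$ or $j>n$. *)

theory Defs
  imports "HOL-Analysis.Polytope"
begin

definition num_faces :: "nat \<Rightarrow> 'a::euclidean_space set \<Rightarrow> nat" where
  "num_faces k P = card {F. F face_of P \<and> aff_dim F = int k}"

(* zeta k n d is meant for d \<le> n \<le> 2 d; with n = d + s the term 2 * d + 1 - n is d + 1 - s,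
   and no truncated subtraction occurs.  It is integer-valued because of the negative terms. *)
definition zeta :: "nat \<Rightarrow> nat \<Rightarrow> nat \<Rightarrow> int" where
  "zeta k n d =
     int ((d + 1) choose (k + 1)) + int (d choose (k + 1))
       - int ((2 * d + 1 - n) choose (k + 1))
     + int ((d - 1) choose k) - int ((2 * d + 1 - n) choose k)"

end

theory Submission
  imports Defs
begin

text \<open>
  Only the face lattice of \<open>P\<close> matters: a finite graded lattice in which every face is the
  intersection of the facets containing it.

  Let \<open>G\<close> be a facet and \<open>v\<^sub>1, \<dots>, v\<^sub>r\<close> the vertices outside \<open>G\<close>. Counting the \<open>k\<close>-faces through
  \<open>v\<^sub>i\<close> that avoid \<open>v\<^sub>1, \<dots>, v\<^bsub>i-1\<^esub>\<close> gives Xue's bound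
  \<open>f\<^sub>k(P) \<ge> f\<^sub>k(G) + \<Sum>\<^sub>i (d-i+1 choose k)\<close>. The \<open>i\<close>-th summand grows by \<open>(d-i-1 choose k-1)\<close> if
  \<open>v\<^sub>i\<close> is not a simple vertex, and by \<open>(d-i choose k-1)\<close> if \<open>v\<^sub>i\<close> is not adjacent to an earlier
  \<open>v\<^sub>j\<close>. If neither ever happens, the outside vertices form a clique of simple vertices, and \<open>P\<close>
  has at most \<open>d+2\<close> facets.

  If every facet is a simplex, the gains over a suitable \<open>G\<close> add up to exactly what is needed;
  this persists for iterated pyramids, where every facet is a simplex or misses one vertex.
  Otherwise some non-simplex facet \<open>G\<close> misses \<open>r \<ge> 2\<close> vertices. For \<open>r \<ge> 3\<close> one gain and the
  bound for \<open>G\<close> with no condition on its facets suffice. For \<open>r = 2\<close>, either \<open>G\<close> has at least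
  \<open>d+2\<close> facets and induction applies together with one gain, or the facets of \<open>P\<close> do not inject
  into the facets of \<open>G\<close> by intersection; then the faces over a shared ridge, or over \<open>J \<inter> G\<close> for a
  facet \<open>J\<close> not adjacent to \<open>G\<close>, supply \<open>(d-1 choose k)\<close> extra faces.
\<close>

section \<open>Convexity of binomial coefficients\<close>

text \<open>Moving one unit from the larger entry \<open>a\<close> to the smaller entry
  \<open>b\<close> lowers the sum by \<open>(a - 1 choose k - 1) - (b choose k - 1)\<close> for
  \<open>k > 0\<close>, which is nonnegative while \<open>b < a\<close>.\<close>

lemma binomial_convex:
  fixes a b c e :: nat
  assumes "a + b = c + e" "c \<le> a" "e \<le> a"
  shows "(c choose k) + (e choose k) \<le> (a choose k) + (b choose k)"
  using assms
proof (induction "a - c" arbitrary: a b)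
  case 0
  then show ?case by simp
next
  case (Suc n)
  then obtain a' where a: "a = Suc a'" "c \<le> a'" by (metis Suc_le_D diff_is_0_eq' le_Suc_eq nat.simps(3) zero_less_Suc zero_less_diff less_eq_Suc_le not_less_eq_eq)
  have be: "b < e" using Suc.prems a by linarith
  show ?case
  proof (cases "e = a")
    case True
    then show ?thesis using Suc.prems by simp
  next
    case False
    then have "(c choose k) + (e choose k) \<le> (a' choose k) + (Suc b choose k)"
      using Suc.hyps Suc.prems a be by (intro Suc.hyps(1)) auto
    moreover have "(a' choose k) + (Suc b choose k) \<le> (a choose k) + (b choose k)"
    proof (cases k)
      case (Suc j)
      have "b choose j \<le> a' choose j"
        using be Suc.prems a False by (intro binomial_right_mono) linarith
      then show ?thesis using a Suc by simp
    qed simp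
    ultimately show ?thesis by linarith
  qed
qed

section \<open>Intervals in face lattices\<close>

text \<open>The rank is the dimension plus one, so that the empty face has rank 0 and vertices rank 1.\<close>

locale face_lattice =
  fixes L :: "'b::{semilattice_inf,order_bot} set" and rk :: "'b \<Rightarrow> nat"
  assumes finite_L: "finite L"
    and bot_L: "bot \<in> L"
    and rk_bot: "rk bot = 0"
    and inf_L: "A \<in> L \<Longrightarrow> B \<in> L \<Longrightarrow> inf A B \<in> L"
    and rk_less: "A \<in> L \<Longrightarrow> B \<in> L \<Longrightarrow> A < B \<Longrightarrow> rk A < rk B"
    and coatom: "E \<in> L \<Longrightarrow> F \<in> L \<Longrightarrow> E < F \<Longrightarrow> \<not> Y \<le> E \<Longrightarrow>
      \<exists>G\<in>L. E \<le> G \<and> G < F \<and> rk F = Suc (rk G) \<and> \<not> Y \<le> G"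
    and edge: "A \<in> L \<Longrightarrow> rk A = 2 \<Longrightarrow> card {v\<in>L. v \<le> A \<and> rk v = 1} \<le> 2"
begin

lemma rk_mono: "A \<in> L \<Longrightarrow> B \<in> L \<Longrightarrow> A \<le> B \<Longrightarrow> rk A \<le> rk B"
  by (metis le_less order_refl rk_less)

lemma rk_eq_imp_eq: "A \<in> L \<Longrightarrow> B \<in> L \<Longrightarrow> A \<le> B \<Longrightarrow> rk B \<le> rk A \<Longrightarrow> A = B"
  by (meson le_less not_less rk_less)

lemma inf_less_iff: "inf H G < H \<longleftrightarrow> \<not> H \<le> G" for H G :: 'b
  by (metis inf.cobounded1 inf.cobounded2 inf.orderE le_less less_irrefl)

lemma facet_containing:
  assumes "E \<in> L" "F \<in> L" "E < F"
  obtains G where "G \<in> L" "E \<le> G" "G < F" "rk F = Suc (rk G)"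
  using coatom[OF assms, of F] assms(3) by (metis leD)

text \<open>Expresses that \<open>E\<close> is the meet of the facets of \<open>F\<close> above it:
  whatever is not below \<open>E\<close> is missed by one of them.\<close>

lemma facet_avoiding:
  assumes "E \<in> L" "F \<in> L" "E < F" "\<not> Y \<le> E"
  obtains G where "G \<in> L" "E \<le> G" "G < F" "rk F = Suc (rk G)" "\<not> Y \<le> G"
  using coatom[OF assms] by metis

text \<open>The dual of \<open>coatom\<close>. Let \<open>H\<close> be minimal among the faces
  between \<open>E\<close> and \<open>F\<close> not below \<open>G\<close>; every smaller face above
  \<open>E\<close> is then below \<open>G\<close>. If \<open>H\<close> were not an atom over
  \<open>E\<close>, it would have two different facets over \<open>E\<close>, and both would equal
  \<open>inf H G\<close>.\<close>

lemma atom: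
  assumes "E \<in> L" "F \<in> L" "G \<in> L" "E \<le> F" "E \<le> G" "\<not> F \<le> G"
  obtains A where "A \<in> L" "E \<le> A" "A \<le> F" "rk A = Suc (rk E)" "\<not> A \<le> G"
proof -
  define Q where "Q H \<longleftrightarrow> H \<in> L \<and> E \<le> H \<and> H \<le> F \<and> \<not> H \<le> G" for H
  obtain H where H: "Q H" and Hmin: "\<And>H'. Q H' \<Longrightarrow> rk H \<le> rk H'"
  proof -
    have "Q F" using assms unfolding Q_def by simp
    from ex_has_least_nat[of Q, OF this, of rk] show thesis using that by blast
  qed
  have HL: "H \<in> L" and EH: "E < H" using H assms unfolding Q_def by auto
  obtain H1 where H1: "H1 \<in> L" "E \<le> H1" "H1 < H" "rk H = Suc (rk H1)"
    by (rule facet_containing[OF assms(1) HL EH])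
  have sub: "H' \<le> G" if "H' \<in> L" "E \<le> H'" "H' < H" for H'
    using Hmin[of H'] rk_less[OF that(1) HL that(3)] that H unfolding Q_def
    by (meson not_less less_imp_le order_trans)
  have "rk H = Suc (rk E)"
  proof (rule ccontr)
    assume ne: "rk H \<noteq> Suc (rk E)"
    then have "\<not> H1 \<le> E" using H1 by auto
    then obtain H2 where H2: "H2 \<in> L" "E \<le> H2" "H2 < H" "rk H = Suc (rk H2)" "\<not> H1 \<le> H2"
      by (rule facet_avoiding[OF assms(1) HL EH])
    have HG: "inf H G \<in> L" "inf H G < H" using HL assms inf_L H unfolding Q_def by (auto simp: inf_less_iff)
    then have r: "rk (inf H G) < rk H" using HL rk_less by blast
    have "H1 = inf H G" using rk_eq_imp_eq[OF H1(1) HG(1)] sub[of H1] H1 r by auto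
    moreover have "H2 = inf H G" using rk_eq_imp_eq[OF H2(1) HG(1)] sub[of H2] H2 r by auto
    ultimately show False using H2 by auto
  qed
  then show thesis using that HL EH H unfolding Q_def by auto
qed

text \<open>For \<open>S = {}\<close> these are the faces of dimension \<open>j - 1\<close> of the quotient polytope \<open>F/E\<close>; the
  elements of \<open>S\<close> are faces to be avoided.\<close>

definition up :: "'b \<Rightarrow> 'b \<Rightarrow> nat \<Rightarrow> 'b set \<Rightarrow> 'b set" where
  "up E F j S = {K\<in>L. E \<le> K \<and> K \<le> F \<and> rk K = rk E + j \<and> (\<forall>x\<in>S. \<not> x \<le> K)}"

lemma finite_up [simp]: "finite (up E F j S)"
  unfolding up_def using finite_L by simp

lemma up_below: "G \<le> F \<Longrightarrow> up E G j S \<subseteq> up E F j S"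
  by (auto simp: up_def)

lemma up_above: "A \<in> up E F 1 {} \<Longrightarrow> up A F j S \<subseteq> up E F (Suc j) S"
  by (auto simp: up_def)

lemma up_antimono: "S \<subseteq> T \<Longrightarrow> up E F j T \<subseteq> up E F j S"
  by (auto simp: up_def)

lemma up_disjoint: "\<not> A \<le> G \<Longrightarrow> up E G i S \<inter> up A F j T = {}"
  by (auto simp: up_def)

lemma up_split:
  assumes "G \<le> F" "A \<in> up E F 1 {}" "\<not> A \<le> G"
  shows "card (up E G (Suc j) S) + card (up A F j S) \<le> card (up E F (Suc j) S)"
proof -
  have "card (up E G (Suc j) S) + card (up A F j S) = card (up E G (Suc j) S \<union> up A F j S)"
    using card_Un_disjoint[OF finite_up finite_up up_disjoint[OF assms(3)]] by simp
  also have "\<dots> \<le> card (up E F (Suc j) S)"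
    using up_below[OF assms(1)] up_above[OF assms(2)] by (intro card_mono finite_up Un_least)
  finally show ?thesis .
qed

text \<open>The three families are told apart by lying below \<open>G\<close>, by containing
  \<open>A\<close>, and by containing \<open>B\<close> but not \<open>A\<close>.\<close>

lemma up_split2:
  assumes "G \<le> F" "A \<in> up E F 1 {}" "\<not> A \<le> G" "B \<in> up E F 1 {}" "\<not> B \<le> G"
  shows "card (up E G (Suc j) S) + card (up A F j S) + card (up B F j (insert A S)) \<le> card (up E F (Suc j) S)"
proof -
  let ?X = "up E G (Suc j) S" and ?Y = "up A F j S" and ?Z = "up B F j (insert A S)"
  have "?Y \<inter> ?Z = {}" by (auto simp: up_def)
  then have d: "(?X \<union> ?Y) \<inter> ?Z = {}" using up_disjoint[OF assms(5)] by blast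
  have "card ?X + card ?Y + card ?Z = card (?X \<union> ?Y) + card ?Z"
    using card_Un_disjoint[OF finite_up finite_up up_disjoint[OF assms(3)]] by simp
  also have "\<dots> = card ((?X \<union> ?Y) \<union> ?Z)"
    using card_Un_disjoint[OF _ finite_up d] by simp
  also have "\<dots> \<le> card (up E F (Suc j) S)"
    by (intro card_mono finite_up Un_least up_below[OF assms(1)] up_above[OF assms(2)]
        order_trans[OF up_above[OF assms(4)] up_antimono]) auto
  finally show ?thesis .
qed

lemma up_atom:
  assumes "E \<in> L" "F \<in> L" "G \<in> L" "E \<le> F" "E \<le> G" "\<not> F \<le> G"
  obtains A where "A \<in> up E F 1 {}" "\<not> A \<le> G"
proof -
  obtain A where "A \<in> L" "E \<le> A" "A \<le> F" "rk A = Suc (rk E)" "\<not> A \<le> G"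
    using atom[OF assms] by blast
  then have "A \<in> up E F 1 {}" unfolding up_def by simp
  then show thesis using that \<open>\<not> A \<le> G\<close> by blast
qed

lemma up_0: "E \<in> L \<Longrightarrow> E \<le> F \<Longrightarrow> \<forall>x\<in>S. \<not> x \<le> E \<Longrightarrow> up E F 0 S = {E}"
proof -
  assume a: "E \<in> L" "E \<le> F" "\<forall>x\<in>S. \<not> x \<le> E"
  have "K = E" if "K \<in> up E F 0 S" for K
    using that rk_eq_imp_eq[OF a(1), of K] by (simp add: up_def)
  moreover have "E \<in> up E F 0 S" using a by (simp add: up_def)
  ultimately show ?thesis by blast
qed

section \<open>Lower bounds for the faces of a quotient\<close>

text \<open>Pascal's rule: a facet \<open>G\<close> over \<open>E\<close> and an atom
  \<open>A\<close> outside it give two intervals shorter by one, whose faces are disjoint.\<close>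

lemma boolean_bound:
  assumes "E \<in> L" "F \<in> L" "E \<le> F"
  shows "(rk F - rk E) choose j \<le> card (up E F j {})"
  using assms
proof (induction "rk F - rk E" arbitrary: E F j)
  case 0
  show ?case
  proof (cases j)
    case 0
    then show ?thesis using "0.prems" up_0[of E F "{}"] by simp
  qed (use "0.hyps" in simp)
next
  case (Suc n)
  show ?case
  proof (cases j)
    case 0
    then show ?thesis using Suc.prems up_0[of E F "{}"] by simp
  next
    case (Suc i)
    have EF: "E < F" using Suc.prems(3) Suc.hyps(2) by (cases "E = F") auto
    obtain G where G: "G \<in> L" "E \<le> G" "G < F" "rk F = Suc (rk G)"
      by (rule facet_containing[OF Suc.prems(1,2) EF])
    obtain A where A: "A \<in> up E F 1 {}" "\<not> A \<le> G"
      by (rule up_atom[OF Suc.prems(1,2) G(1) Suc.prems(3) G(2)]) (use G(3) in auto)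
    have rank: "n = rk G - rk E" "n = rk F - rk A"
      using Suc.hyps(2) G(4) A(1) by (auto simp: up_def)
    have "n choose j \<le> card (up E G j {})"
      using Suc.hyps(1)[of G E j] rank(1) Suc.prems G(1,2,4) by simp
    moreover have "n choose i \<le> card (up A F i {})"
      using Suc.hyps(1)[of F A i] rank(2) Suc.prems(2) A(1) by (simp add: up_def)
    ultimately show ?thesis
      using up_split[OF less_imp_le[OF G(3)] A, of i "{}"] Suc by (simp flip: Suc.hyps(2))
  qed
qed

text \<open>Each element of \<open>S\<close> costs at most one rank: if it lies below the face
  reached so far, that face is replaced by a facet of it that contains \<open>E\<close> and misses
  the element.\<close>

lemma avoid_face:
  assumes "E \<in> L" "F \<in> L" "E \<le> F" "finite S" "\<forall>x\<in>S. \<not> x \<le> E"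
  obtains G where "G \<in> L" "E \<le> G" "G \<le> F" "\<forall>x\<in>S. \<not> x \<le> G" "rk F \<le> rk G + card S"
proof -
  have "\<exists>G\<in>L. E \<le> G \<and> G \<le> F \<and> (\<forall>x\<in>S. \<not> x \<le> G) \<and> rk F \<le> rk G + card S"
    using assms(4,5)
  proof (induction S)
    case empty
    then show ?case using assms by auto
  next
    case (insert x S)
    then obtain G where G: "G \<in> L" "E \<le> G" "G \<le> F" "\<forall>x\<in>S. \<not> x \<le> G" "rk F \<le> rk G + card S"
      by auto
    show ?case
    proof (cases "x \<le> G")
      case False
      then show ?thesis using G insert.hyps by (intro bexI[of _ G]) auto
    next
      case True
      then have "E < G" using G insert.prems by auto
      then obtain G' where "G' \<in> L" "E \<le> G'" "G' < G" "rk G = Suc (rk G')" "\<not> x \<le> G'"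
        using coatom[of E G x] assms(1) G(1) insert.prems by blast
      moreover have "\<forall>y\<in>insert x S. \<not> y \<le> G'"
        using \<open>G' < G\<close> \<open>\<not> x \<le> G'\<close> G(4) by (auto dest: less_imp_le)
      ultimately show ?thesis using G insert.hyps by (intro bexI[of _ G']) auto
    qed
  qed
  then show thesis using that by blast
qed

lemma avoid_bound:
  assumes "E \<in> L" "F \<in> L" "E \<le> F" "finite S" "\<forall>x\<in>S. \<not> x \<le> E" "n + card S \<le> rk F - rk E"
  shows "n choose j \<le> card (up E F j S)"
proof -
  obtain G where G: "G \<in> L" "E \<le> G" "G \<le> F" "\<forall>x\<in>S. \<not> x \<le> G" "rk F \<le> rk G + card S"
    by (rule avoid_face[OF assms(1-5)])
  have "n choose j \<le> (rk G - rk E) choose j"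
    using assms(6) G by (intro binomial_right_mono) linarith
  also have "\<dots> \<le> card (up E G j {})" using boolean_bound assms G by blast
  also have "\<dots> \<le> card (up E F j S)"
  proof (intro card_mono finite_up subsetI)
    fix K assume "K \<in> up E G j {}"
    then show "K \<in> up E F j S"
      using G(3,4) by (auto simp: up_def)
  qed
  finally show ?thesis .
qed

text \<open>Every face \<open>K\<close> of \<open>G\<close> extends to a face \<open>h K\<close> one
  rank higher outside \<open>G\<close>, and \<open>inf (h K) G = K\<close> recovers
  \<open>K\<close>. So \<open>F\<close> has at least as many faces as a pyramid over
  \<open>G\<close>.\<close>

lemma facet_extend:
  assumes "E \<in> L" "F \<in> L" "G \<in> L" "E \<le> G" "G < F"
  shows "card (up E G (Suc j) {}) + card (up E G j {}) \<le> card (up E F (Suc j) {})"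
proof -
  define h where "h K = (SOME A. A \<in> up K F 1 {} \<and> \<not> A \<le> G)" for K
  have h: "h K \<in> up K F 1 {}" "\<not> h K \<le> G" if "K \<in> up E G j {}" for K
  proof -
    have "\<exists>A. A \<in> up K F 1 {} \<and> \<not> A \<le> G"
    proof -
      have "K \<in> L" "K \<le> F" "K \<le> G" "\<not> F \<le> G" using that assms by (auto simp: up_def)
      from up_atom[OF this(1) assms(2,3) this(2-4)] show ?thesis by metis
    qed
    from someI_ex[OF this] show "h K \<in> up K F 1 {}" "\<not> h K \<le> G" unfolding h_def by blast+
  qed
  have hG: "inf (h K) G = K" if K: "K \<in> up E G j {}" for K
  proof -
    have 1: "h K \<in> L" "K \<le> h K" "rk (h K) = Suc (rk K)" "K \<in> L" "K \<le> G"
      using h(1)[OF K] K by (simp_all add: up_def)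
    have 2: "inf (h K) G \<in> L" using inf_L 1(1) assms(3) by simp
    have "inf (h K) G < h K" using h(2)[OF K] by (simp add: inf_less_iff)
    then have "rk (inf (h K) G) < rk (h K)" by (rule rk_less[OF 2 1(1)])
    then show ?thesis using rk_eq_imp_eq[OF 1(4) 2] 1 by simp
  qed
  have "inj_on h (up E G j {})" using hG by (metis inj_onI)
  then have "card (up E G (Suc j) {}) + card (up E G j {}) = card (up E G (Suc j) {}) + card (h ` up E G j {})"
    by (simp add: card_image)
  also have "\<dots> = card (up E G (Suc j) {} \<union> h ` up E G j {})"
  proof (intro card_Un_disjoint[symmetric] finite_up finite_imageI)
    have "X \<le> G" if "X \<in> up E G (Suc j) {}" for X using that by (simp add: up_def)
    then show "up E G (Suc j) {} \<inter> h ` up E G j {} = {}" using h(2) by blast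
  qed
  also have "\<dots> \<le> card (up E F (Suc j) {})"
  proof (rule card_mono[OF finite_up])
    have "h K \<in> up E F (Suc j) {}" if "K \<in> up E G j {}" for K
      using h(1)[OF that] that by (auto simp: up_def)
    moreover have "up E G (Suc j) {} \<subseteq> up E F (Suc j) {}"
      using up_below assms(5) by simp
    ultimately show "up E G (Suc j) {} \<union> h ` up E G j {} \<subseteq> up E F (Suc j) {}" by blast
  qed
  finally show ?thesis .
qed

lemma up_avoid_below:
  "G \<le> F \<Longrightarrow> (\<And>x. x \<in> S \<Longrightarrow> x \<in> T \<or> \<not> x \<le> G) \<Longrightarrow> card (up E G j T) \<le> card (up E F j S)"
  by (intro card_mono finite_up) (force simp: up_def)

lemma inf_atom:
  assumes "E \<in> L" "G \<in> L" "E \<le> G" "A \<in> up E F 1 {}" "\<not> A \<le> G"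
  shows "inf A G = E"
proof -
  have A: "A \<in> L" "E \<le> A" "rk A = Suc (rk E)" using assms(4) by (auto simp: up_def)
  have i: "inf A G \<in> L" using inf_L A assms by simp
  then have "rk (inf A G) < rk A" using rk_less[OF i A(1)] assms(5) by (simp add: inf_less_iff)
  then show ?thesis using rk_eq_imp_eq[OF assms(1) i] A assms(3) by simp
qed

text \<open>The hypothesis says that the quotient \<open>F/E\<close> is not a simplex. If its facets are all simplices,
  two atoms outside one of them give the extra term; otherwise pass to a non-simplex facet.\<close>

lemma nonboolean_bound:
  assumes "E \<in> L" "F \<in> L" "E \<le> F" "rk F = rk E + (m + card S + 2)"
    and "m + card S + 2 < card (up E F 1 {})" "finite S" "\<forall>x\<in>S. \<not> x \<le> E"
  shows "((m + 2) choose Suc j) + (m choose j) \<le> card (up E F (Suc j) S)"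
  using assms
proof (induction "m + card S" arbitrary: F m j S rule: less_induct)
  case less
  note EL = less.prems(1) and FL = less.prems(2) and EF = less.prems(3) and rkF = less.prems(4)
    and at = less.prems(5) and fin = less.prems(6) and av = less.prems(7)
  have lt: "E < F" using EF rkF by (cases "E = F") auto
  have outside: "\<exists>A B. A \<noteq> B \<and> A \<in> up E F 1 {} \<and> B \<in> up E F 1 {} \<and> \<not> A \<le> G \<and> \<not> B \<le> G"
    if "G < F" "card (up E G 1 {}) < m + card S + 2" for G
  proof -
    have sub: "up E G 1 {} \<subseteq> up E F 1 {}" using that up_below by simp
    have "2 \<le> card (up E F 1 {} - up E G 1 {})"
      using at that by (subst card_Diff_subset[OF finite_up sub]) simp
    then obtain X where "X \<subseteq> up E F 1 {} - up E G 1 {}" "card X = 2"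
      by (metis obtain_subset_with_card_n)
    then obtain A B where "A \<noteq> B" "{A, B} \<subseteq> up E F 1 {} - up E G 1 {}"
      by (auto simp: card_2_iff)
    then show ?thesis by (intro exI[of _ A] exI[of _ B]) (auto simp: up_def)
  qed
  show ?case
  proof (cases "S = {}")
    case True
    show ?thesis
    proof (cases "\<exists>G\<in>L. E \<le> G \<and> G < F \<and> rk F = Suc (rk G) \<and> m + 2 \<le> card (up E G 1 {})")
      case True
      then obtain G where G: "G \<in> L" "E \<le> G" "G < F" "rk F = Suc (rk G)" "m + 2 \<le> card (up E G 1 {})"
        by blast
      show ?thesis
      \<comment> \<open>For \<open>m = 0\<close> the facet \<open>G\<close> would itself be an atom
        over \<open>E\<close>, with no room for two atoms below it.\<close>
      proof (cases m)
        case 0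
        then have "up E G 1 {} \<subseteq> {G}"
          using rk_eq_imp_eq G rkF \<open>S = {}\<close> by (auto simp: up_def)
        then have "card (up E G 1 {}) \<le> 1" using card_mono[of "{G}"] by simp
        then show ?thesis using G by simp
      next
        case (Suc n)
        have IH: "((n + 2) choose Suc i) + (n choose i) \<le> card (up E G (Suc i) {})" for i
          using less.hyps[of n "{}" G i] Suc EL G rkF \<open>S = {}\<close> by simp
        show ?thesis
        proof (cases j)
          case 0
          then show ?thesis using at \<open>S = {}\<close> by simp
        next
          case (Suc i)
          then show ?thesis
            using IH[of i] IH[of j] facet_extend[OF EL FL G(1-3), of j] \<open>S = {}\<close> \<open>m = Suc n\<close>
            by simp
        qed
      qed
    next
      case False
      obtain G where G: "G \<in> L" "E \<le> G" "G < F" "rk F = Suc (rk G)"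
        by (rule facet_containing[OF EL FL lt])
      have "card (up E G 1 {}) < m + card S + 2" using False G \<open>S = {}\<close> by auto
      from outside[OF G(3) this] obtain A B where AB: "A \<noteq> B" "A \<in> up E F 1 {}" "B \<in> up E F 1 {}"
        "\<not> A \<le> G" "\<not> B \<le> G" by blast
      have AB': "A \<in> L" "B \<in> L" "A \<le> F" "B \<le> F" "rk A = Suc (rk E)" "rk B = Suc (rk E)"
        using AB by (auto simp: up_def)
      then have "\<not> A \<le> B" using rk_eq_imp_eq AB(1) by auto
      then have "m choose j \<le> card (up B F j {A})"
        using avoid_bound[of B F "{A}" m j] AB' FL rkF \<open>S = {}\<close> by simp
      moreover have "(m + 1) choose j \<le> card (up A F j {})"
        using boolean_bound[of A F j] AB' FL rkF \<open>S = {}\<close> by simp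
      moreover have "(m + 1) choose Suc j \<le> card (up E G (Suc j) {})"
        using avoid_bound[of E G "{}" "m + 1" "Suc j"] EL G rkF \<open>S = {}\<close> by simp
      ultimately show ?thesis
        using up_split2[OF less_imp_le[OF G(3)] AB(2,4,3,5), of j "{}"] \<open>S = {}\<close> by simp
    qed
  next
    case False
    then obtain x where x: "x \<in> S" by blast
    define T where "T = S - {x}"
    have T: "finite T" "card S = Suc (card T)" "\<forall>x\<in>T. \<not> x \<le> E"
      using x fin av card_Suc_Diff1[of S x] by (auto simp: T_def)
    obtain G where G: "G \<in> L" "E \<le> G" "G < F" "rk F = Suc (rk G)" "\<not> x \<le> G"
      by (rule facet_avoiding[OF EL FL lt]) (use x av in blast)
    have TG: "card (up E G i T) \<le> card (up E F i S)" "card (up E G i T) \<le> card (up E G i S)" for i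
      using G by (intro up_avoid_below; auto simp: T_def)+
    show ?thesis
    \<comment> \<open>Passing to \<open>G\<close> uses up one rank and the element \<open>x\<close>
      of \<open>S\<close>, so \<open>m\<close> is kept; if \<open>G/E\<close> is not a simplex,
      induction applies.\<close>
    proof (cases "m + card S + 2 \<le> card (up E G 1 {})")
      case True
      then have "((m + 2) choose Suc j) + (m choose j) \<le> card (up E G (Suc j) T)"
        using T EL G rkF by (intro less.hyps) auto
      then show ?thesis using TG(1) le_trans by blast
    next
      case out: False
      then obtain A B where AB: "A \<noteq> B" "A \<in> up E F 1 {}" "B \<in> up E F 1 {}"
        "\<not> A \<le> G" "\<not> B \<le> G" using outside[OF G(3)] by force
      show ?thesis
      proof (cases "\<exists>u\<in>up E F 1 {}. \<not> u \<le> G \<and> (\<forall>y\<in>S. \<not> y \<le> u)")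
        case True
        then obtain u where u: "u \<in> up E F 1 {}" "\<not> u \<le> G" "\<forall>y\<in>S. \<not> y \<le> u" by blast
        then have u': "u \<in> L" "u \<le> F" "rk u = Suc (rk E)" by (auto simp: up_def)
        have "(m + 2) choose Suc j \<le> card (up E G (Suc j) T)"
          using T EL G rkF by (intro avoid_bound) auto
        moreover have "m choose j \<le> card (up u F j S)"
          using u u' fin FL rkF by (intro avoid_bound) auto
        ultimately show ?thesis
          using up_split[OF less_imp_le[OF G(3)] u(1,2), of j S] TG(2)[of "Suc j"] by simp
      next
        case False
        \<comment> \<open>\<open>A\<close> and \<open>B\<close> meet in \<open>E\<close>, so they
          contain different elements of \<open>S\<close>, and neither of these is below
          \<open>G\<close>. Thus \<open>G\<close> avoids two elements of \<open>S\<close> at the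
          price of one rank.\<close>
        then obtain y z where yz: "y \<in> S" "z \<in> S" "y \<le> A" "z \<le> B" using AB by meson
        have AB': "A \<in> L" "B \<in> L" "E \<le> A" "E \<le> B" "rk A = Suc (rk E)" "rk B = Suc (rk E)"
          using AB by (auto simp: up_def)
        then have "\<not> A \<le> B" using rk_eq_imp_eq AB(1) by auto
        then have "inf A B = E" using inf_atom[OF EL AB'(2,4) AB(2)] by simp
        then have "y \<noteq> z" using yz av by (metis le_infI)
        have ny: "\<not> y \<le> G" using inf_atom[OF EL G(1,2) AB(2,4)] yz av by (metis le_infI)
        have nz: "\<not> z \<le> G" using inf_atom[OF EL G(1,2) AB(3,5)] yz av by (metis le_infI)
        define R where "R = S - {y, z}"
        have R: "finite R" "card S = card R + 2" "\<forall>x\<in>R. \<not> x \<le> E"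
          using fin av yz \<open>y \<noteq> z\<close> card_Diff_subset[of "{y,z}" S] card_mono[of S "{y,z}"] by (auto simp: R_def)
        have "(m + 3) choose Suc j \<le> card (up E G (Suc j) R)"
          using R EL G rkF by (intro avoid_bound) auto
        also have "\<dots> \<le> card (up E F (Suc j) S)"
          using G ny nz by (intro up_avoid_below) (auto simp: R_def)
        finally have "((m + 2) choose Suc j) + ((m + 2) choose j) \<le> card (up E F (Suc j) S)"
          by (simp add: numeral_3_eq_3 numeral_2_eq_2)
        then show ?thesis using binomial_right_mono[of m "m + 2" j] by linarith
      qed
    qed
  qed
qed

text \<open>For a vertex \<open>E\<close>, the condition on \<open>x\<close> says that no edge joins
  them. A facet \<open>G\<close> missing \<open>x\<close> has only \<open>S - {x}\<close> left to
  avoid, which gives the first term. An atom \<open>u\<close> outside \<open>G\<close> cannot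
  contain \<open>x\<close>: if \<open>u\<close> avoids \<open>S\<close>, the faces through it give
  the second term; otherwise \<open>G\<close> misses two elements of \<open>S\<close>.\<close>

lemma nonadjacent_bound:
  assumes EL: "E \<in> L" and FL: "F \<in> L" and "E \<le> F" and rkF: "rk F = rk E + (m + card S + 1)"
    and fin: "finite S" and av: "\<forall>x\<in>S. \<not> x \<le> E"
    and x: "x \<in> S" "\<forall>A\<in>up E F 1 {}. \<not> x \<le> A"
  shows "((m + 1) choose Suc j) + (m choose j) \<le> card (up E F (Suc j) S)"
proof -
  have lt: "E < F" using assms(3) rkF by (cases "E = F") auto
  define T where "T = S - {x}"
  have T: "finite T" "card S = Suc (card T)" "\<forall>x\<in>T. \<not> x \<le> E"
    using x fin av card_Suc_Diff1[of S x] by (auto simp: T_def)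
  obtain G where G: "G \<in> L" "E \<le> G" "G < F" "rk F = Suc (rk G)" "\<not> x \<le> G"
    by (rule facet_avoiding[OF EL FL lt]) (use x av in blast)
  obtain u where u: "u \<in> up E F 1 {}" "\<not> u \<le> G"
    by (rule up_atom[OF EL FL G(1) assms(3) G(2)]) (use G(3) in auto)
  then have u': "u \<in> L" "u \<le> F" "rk u = Suc (rk E)" by (auto simp: up_def)
  show ?thesis
  proof (cases "\<forall>y\<in>S. \<not> y \<le> u")
    case True
    have "(m + 1) choose Suc j \<le> card (up E G (Suc j) T)"
      using T EL G rkF by (intro avoid_bound) auto
    also have "\<dots> \<le> card (up E G (Suc j) S)"
      using G by (intro up_avoid_below; auto simp: T_def)+
    finally have "(m + 1) choose Suc j \<le> card (up E G (Suc j) S)" .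
    moreover have "m choose j \<le> card (up u F j S)"
      using u' True fin FL rkF by (intro avoid_bound) auto
    ultimately show ?thesis
      using up_split[OF less_imp_le[OF G(3)] u, of j S] by simp
  next
    case False
    then obtain y where y: "y \<in> S" "y \<le> u" by blast
    then have "y \<noteq> x" using x u by blast
    have ny: "\<not> y \<le> G" using inf_atom[OF EL G(1,2) u] y av by (metis le_infI)
    define R where "R = S - {x, y}"
    have R: "finite R" "card S = card R + 2" "\<forall>x\<in>R. \<not> x \<le> E"
      using fin av y x \<open>y \<noteq> x\<close> card_Diff_subset[of "{x,y}" S] card_mono[of S "{x,y}"] by (auto simp: R_def)
    have "(m + 2) choose Suc j \<le> card (up E G (Suc j) R)"
      using R EL G rkF by (intro avoid_bound) auto
    also have "\<dots> \<le> card (up E F (Suc j) S)"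
      using G ny by (intro up_avoid_below) (auto simp: R_def)
    finally have "((m + 1) choose Suc j) + ((m + 1) choose j) \<le> card (up E F (Suc j) S)"
      by (simp add: numeral_2_eq_2)
    then show ?thesis using binomial_right_mono[of m "m + 1" j] by linarith
  qed
qed

section \<open>Counting faces that meet a set of vertices\<close>

definition touch :: "'b \<Rightarrow> nat \<Rightarrow> 'b set \<Rightarrow> nat" where
  "touch F k S = card {K\<in>L. K \<le> F \<and> rk K = k \<and> (\<exists>v\<in>S. v \<le> K)}"

definition verts :: "'b \<Rightarrow> 'b set" where
  "verts F = up bot F 1 {}"

lemma verts_iff: "v \<in> verts F \<longleftrightarrow> v \<in> L \<and> v \<le> F \<and> rk v = 1"
  by (auto simp: verts_def up_def rk_bot)

lemma finite_verts [simp]: "finite (verts F)"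
  by (simp add: verts_def)

lemma verts_mono: "G \<le> F \<Longrightarrow> verts G \<subseteq> verts F"
  by (auto simp: verts_iff)

lemma faces_iff: "K \<in> up bot F k {} \<longleftrightarrow> K \<in> L \<and> K \<le> F \<and> rk K = k"
  by (auto simp: up_def rk_bot)

lemma verts_subset_iff:
  assumes "F \<in> L" "G \<in> L"
  shows "verts F \<subseteq> verts G \<longleftrightarrow> F \<le> G"
proof
  assume "verts F \<subseteq> verts G"
  show "F \<le> G"
  proof (rule ccontr)
    assume "\<not> F \<le> G"
    then obtain A where "A \<in> up bot F 1 {}" "\<not> A \<le> G"
      by (rule up_atom[OF bot_L assms bot_least bot_least])
    then have "A \<in> verts F" by (simp only: verts_def)
    then show False using \<open>verts F \<subseteq> verts G\<close> \<open>\<not> A \<le> G\<close> by (auto simp: verts_iff)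
  qed
qed (simp add: verts_mono)

text \<open>Lets vertices be counted one at a time: those faces are new at \<open>v\<close> that
  avoid all earlier vertices.\<close>

lemma touch_insert:
  assumes "v \<in> L" "rk v = 1"
  shows "touch F (Suc j) (insert v S) = touch F (Suc j) S + card (up v F j S)"
proof -
  have "{K \<in> L. K \<le> F \<and> rk K = Suc j \<and> (\<exists>u\<in>insert v S. u \<le> K)} =
      {K \<in> L. K \<le> F \<and> rk K = Suc j \<and> (\<exists>u\<in>S. u \<le> K)} \<union> up v F j S"
    using assms by (auto simp: up_def)
  moreover have "{K \<in> L. K \<le> F \<and> rk K = Suc j \<and> (\<exists>u\<in>S. u \<le> K)} \<inter> up v F j S = {}"
    by (auto simp: up_def)
  ultimately show ?thesis
    unfolding touch_def using finite_L by (simp add: card_Un_disjoint)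
qed

lemma touch_empty [simp]: "touch F k {} = 0"
  unfolding touch_def by simp

lemma touch_facet:
  assumes "G \<le> F" "\<forall>v\<in>S. \<not> v \<le> G"
  shows "card (up bot G k {}) + touch F k S \<le> card (up bot F k {})"
proof -
  let ?T = "{K \<in> L. K \<le> F \<and> rk K = k \<and> (\<exists>v\<in>S. v \<le> K)}"
  have "card (up bot G k {}) + card ?T = card (up bot G k {} \<union> ?T)"
    using assms finite_L by (intro card_Un_disjoint[symmetric]) (auto simp: faces_iff)
  also have "\<dots> \<le> card (up bot F k {})"
    using assms by (intro card_mono finite_up) (auto simp: faces_iff)
  finally show ?thesis unfolding touch_def .
qed

lemma verts_avoid:
  assumes "v \<in> verts F" "S \<subseteq> verts F" "v \<notin> S"
  shows "finite S" "\<forall>x\<in>S. \<not> x \<le> v"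
proof -
  show "finite S" by (rule finite_subset[OF assms(2) finite_verts])
  show "\<forall>x\<in>S. \<not> x \<le> v"
  proof (intro ballI notI)
    fix x assume "x \<in> S" "x \<le> v"
    then show False using rk_eq_imp_eq[of x v] assms by (auto simp: verts_iff)
  qed
qed

lemma vertex_bound:
  assumes "F \<in> L" "rk F = Suc d" "v \<in> verts F" "S \<subseteq> verts F" "v \<notin> S" "m + card S \<le> d"
  shows "m choose j \<le> card (up v F j S)"
  using assms verts_avoid[OF assms(3-5)] by (intro avoid_bound) (auto simp: verts_iff)

text \<open>Telescoped form of the sum over the vertices: a vertex added after
  \<open>n \<le> d\<close> others brings at least \<open>(d - n choose j)\<close> new faces, which
  is exactly the drop of the correction term \<open>(d + 1 - n choose Suc j)\<close>.\<close>

lemma touch_extend: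
  assumes FL: "F \<in> L" and rkF: "rk F = Suc d" and "S0 \<subseteq> S" and S: "S \<subseteq> verts F"
  shows "touch F (Suc j) S0 + ((d + 1 - card S0) choose Suc j)
    \<le> touch F (Suc j) S + ((d + 1 - card S) choose Suc j)"
proof -
  have fin: "finite S" by (rule finite_subset[OF S finite_verts])
  then have finR: "finite (S - S0)" by simp
  have "touch F (Suc j) S0 + ((d + 1 - card S0) choose Suc j)
    \<le> touch F (Suc j) (S0 \<union> R) + ((d + 1 - card (S0 \<union> R)) choose Suc j)" if "R \<subseteq> S - S0" for R
    using finite_subset[OF that finR] that
  proof (induction R rule: finite_induct)
    case (insert v R)
    let ?Q = "S0 \<union> R"
    have v: "v \<in> verts F" "?Q \<subseteq> verts F" "v \<notin> ?Q" using insert S assms(3) by auto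
    have cQ: "card (insert v ?Q) = Suc (card ?Q)" using verts_avoid(1)[OF v] v by simp
    have "((d + 1 - card ?Q) choose Suc j) \<le> card (up v F j ?Q) + ((d - card ?Q) choose Suc j)"
    \<comment> \<open>After more than \<open>d\<close> vertices both truncated differences are 0 and
      the binomials vanish.\<close>
    proof (cases "card ?Q \<le> d")
      case True
      then have "(d - card ?Q) choose j \<le> card (up v F j ?Q)"
        using FL rkF v by (intro vertex_bound) auto
      then show ?thesis using True by (simp add: Suc_diff_le)
    qed simp
    moreover have "touch F (Suc j) (insert v ?Q) = touch F (Suc j) ?Q + card (up v F j ?Q)"
      using v by (intro touch_insert) (auto simp: verts_iff)
    moreover have "touch F (Suc j) S0 + ((d + 1 - card S0) choose Suc j)
      \<le> touch F (Suc j) ?Q + ((d + 1 - card ?Q) choose Suc j)" using insert by auto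
    ultimately show ?case using cQ by simp
  qed simp
  from this[of "S - S0"] show ?thesis using assms(3) by (simp add: Un_absorb1)
qed

lemma verts_card_ge:
  assumes "F \<in> L" shows "rk F \<le> card (verts F)"
  using boolean_bound[OF bot_L assms bot_least, of 1] by (simp add: rk_bot verts_def)

text \<open>A facet \<open>R\<close> of \<open>G\<close> is \<open>inf G H\<close> for another facet
  \<open>H\<close> of \<open>F\<close>. The single vertices missed by \<open>G\<close> and by
  \<open>H\<close> differ, so \<open>R\<close> misses just one vertex of \<open>G\<close>. Hence the
  hypothesis passes to \<open>G\<close>, which is a simplex by induction.\<close>

lemma simplex_if_facets_miss_one:
  assumes "F \<in> L" "rk F = Suc d"
    and "\<And>G. G \<in> up bot F d {} \<Longrightarrow> Suc (card (verts G)) = card (verts F)"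
  shows "card (verts F) = Suc d"
  using assms
proof (induction d arbitrary: F)
  case 0
  then have "verts F = {F}" using rk_eq_imp_eq by (auto simp: verts_iff)
  then show ?case by simp
next
  case (Suc d)
  have miss: "\<exists>a. verts F - verts G = {a}" if "G \<in> up bot F (Suc d) {}" for G
  proof -
    have sub: "verts G \<subseteq> verts F" using that verts_mono by (simp add: faces_iff)
    have "card (verts F - verts G) = 1"
      using Suc.prems(3)[OF that] by (subst card_Diff_subset[OF finite_verts sub]) simp
    then show ?thesis by (simp add: card_1_singleton_iff)
  qed
  have "bot < F" using Suc.prems rk_bot by (metis bot.not_eq_extremum nat.distinct(1))
  then obtain G where G: "G \<in> L" "G < F" "rk F = Suc (rk G)"
    using facet_containing[OF bot_L Suc.prems(1)] by blast
  have GF: "G \<in> up bot F (Suc d) {}" using G Suc.prems by (simp add: faces_iff)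
  have "card (verts G) = Suc d"
  proof (rule Suc.IH[OF G(1)])
    show "rk G = Suc d" using G Suc.prems by simp
    fix R assume "R \<in> up bot G d {}"
    then have R: "R \<in> L" "R \<le> G" "rk R = d" by (auto simp: faces_iff)
    have "R < F" using R G by simp
    have "\<not> G \<le> R" using R G Suc.prems rk_mono[of G R] by auto
    obtain H where H: "H \<in> L" "R \<le> H" "H < F" "rk F = Suc (rk H)" "\<not> G \<le> H"
      by (rule facet_avoiding[OF R(1) Suc.prems(1) \<open>R < F\<close> \<open>\<not> G \<le> R\<close>])
    have HF: "H \<in> up bot F (Suc d) {}" using H Suc.prems by (simp add: faces_iff)
    have i: "inf G H \<in> L" using inf_L G H by simp
    have "rk (inf G H) < rk G" using rk_less[OF i G(1)] H by (simp add: inf_less_iff)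
    then have "R = inf G H" using rk_eq_imp_eq[OF R(1) i] R H G Suc.prems by simp
    then have vR: "verts R = verts G \<inter> verts H" by (auto simp: verts_iff)
    obtain a where a: "verts F - verts G = {a}" using miss[OF GF] by (elim exE)
    obtain b where b: "verts F - verts H = {b}" using miss[OF HF] by (elim exE)
    have sub: "verts G \<subseteq> verts F" "verts H \<subseteq> verts F"
      using G(2) H(3) by (simp_all add: verts_mono)
    have "a \<noteq> b"
    proof
      assume "a = b"
      then have "verts G \<subseteq> verts H" using a b sub by blast
      then show False using verts_subset_iff[OF G(1) H(1)] H by simp
    qed
    have "verts G - {b} = verts R" "b \<in> verts G" 
    proof -
      have b': "b \<in> verts F" "b \<notin> verts H" "\<And>x. x \<in> verts F \<Longrightarrow> x \<notin> verts H \<Longrightarrow> x = b"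
        using b by blast+
      show "b \<in> verts G" using b'(1) a \<open>a \<noteq> b\<close> by (metis DiffI singletonD)
      show "verts G - {b} = verts R" using vR sub(1) b'(2,3) by auto
    qed
    then show "Suc (card (verts R)) = card (verts G)"
      by (metis card_Suc_Diff1 finite_verts)
  qed
  then show ?case using Suc.prems(3)[OF GF] by simp
qed

lemma facet_missing_two:
  assumes "F \<in> L" "rk F = Suc d" "Suc d < card (verts F)"
  obtains G where "G \<in> up bot F d {}" "card (verts G) + 2 \<le> card (verts F)"
proof -
  obtain G where G: "G \<in> up bot F d {}" "Suc (card (verts G)) \<noteq> card (verts F)"
    using simplex_if_facets_miss_one[OF assms(1,2)] assms(3) by auto
  then have G': "G \<in> L" "G \<le> F" "rk G = d" by (auto simp: faces_iff)
  have "\<not> F \<le> G" using rk_mono[of F G] G' assms by auto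
  then have "verts G \<subset> verts F" using verts_subset_iff G' assms(1) by blast
  then have "card (verts G) < card (verts F)" by (intro psubset_card_mono) auto
  then show thesis using that[OF G(1)] G(2) by linarith
qed

lemma facet_split:
  assumes "F \<in> L" "G \<in> L" "G \<le> F"
  shows "card (verts F) = card (verts G) + card {v\<in>verts F. \<not> v \<le> G}"
proof -
  have "verts F = verts G \<union> {v\<in>verts F. \<not> v \<le> G}"
    using assms by (auto simp: verts_iff)
  moreover have "card (verts G \<union> {v\<in>verts F. \<not> v \<le> G}) = card (verts G) + card {v\<in>verts F. \<not> v \<le> G}"
    by (intro card_Un_disjoint) (auto simp: verts_iff finite_L)
  ultimately show ?thesis by simp
qed

text \<open>Gruenbaum's lower bound for at most \<open>2 * d\<close> vertices, with the subtracted
  term moved to the right. Induction on a facet \<open>G\<close>, adding the faces that meet the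
  vertices outside it.\<close>

theorem xue_bound:
  assumes "F \<in> L" "rk F = Suc d" "card (verts F) = d + s" "1 \<le> s" "s \<le> d"
  shows "(Suc d choose Suc j) + (d choose Suc j) \<le> card (up bot F (Suc j) {}) + ((d + 1 - s) choose Suc j)"
  using assms
proof (induction d arbitrary: F s)
  case (Suc e)
  show ?case
  proof (cases "s = 1")
    case True
    then show ?thesis
      using boolean_bound[OF bot_L Suc.prems(1) bot_least, of "Suc j"] Suc.prems by (simp add: rk_bot)
  next
    case False
    \<comment> \<open>Missing two vertices forces \<open>s' \<le> s - 1 \<le> e\<close> for the
      excess \<open>s'\<close> of \<open>G\<close>, as the induction hypothesis demands.\<close>
    obtain G where G: "G \<in> up bot F (Suc e) {}" "card (verts G) + 2 \<le> card (verts F)"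
      by (rule facet_missing_two[OF Suc.prems(1,2)]) (use Suc.prems False in auto)
    then have G': "G \<in> L" "G \<le> F" "rk G = Suc e" by (auto simp: faces_iff)
    define W where "W = {v\<in>verts F. \<not> v \<le> G}"
    define s' where "s' = card (verts G) - e"
    have s': "card (verts G) = e + s'" "1 \<le> s'"
      using verts_card_ge[OF G'(1)] G' by (auto simp: s'_def)
    have r: "Suc e + s = e + s' + card W" using facet_split[OF Suc.prems(1) G'(1,2)] Suc.prems s' by (simp add: W_def)
    have IH: "(Suc e choose Suc j) + (e choose Suc j) \<le> card (up bot G (Suc j) {}) + ((e + 1 - s') choose Suc j)"
      using Suc.IH[OF G'(1,3) s'] G(2) s' Suc.prems by simp
    have "(Suc (Suc e) choose Suc j) \<le> touch F (Suc j) W + ((Suc (Suc e) - card W) choose Suc j)"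
      using touch_extend[of F "Suc e" "{}" W j] Suc.prems by (simp add: W_def)
    moreover have "card (up bot G (Suc j) {}) + touch F (Suc j) W \<le> card (up bot F (Suc j) {})"
      using touch_facet G' by (simp add: W_def)
    \<comment> \<open>Both sides have index sum \<open>2 * e + 2 - s\<close>, and \<open>e\<close>
      is the largest index because \<open>1 \<le> s'\<close> and
      \<open>2 \<le> card W\<close>.\<close>
    moreover have "((e + 1 - s') choose Suc j) + ((Suc (Suc e) - card W) choose Suc j)
        \<le> (e choose Suc j) + ((Suc e + 1 - s) choose Suc j)"
      using s' r G(2) Suc.prems by (intro binomial_convex) auto
    ultimately show ?thesis using IH by simp
  qed
qed simp


section \<open>Gains at non-simple vertices and nonadjacent pairs\<close>

definition edges :: "'b \<Rightarrow> 'b \<Rightarrow> 'b set" where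
  "edges v F = up v F 1 {}"

lemma edges_iff: "A \<in> edges v F \<longleftrightarrow> A \<in> L \<and> v \<le> A \<and> A \<le> F \<and> rk A = Suc (rk v)"
  by (auto simp: edges_def up_def)

lemma finite_edges [simp]: "finite (edges v F)"
  by (simp add: edges_def)

lemma edges_card_ge:
  assumes "F \<in> L" "v \<in> verts F" "rk F = Suc d"
  shows "d \<le> card (edges v F)"
  using boolean_bound[of v F 1] assms by (simp add: edges_def verts_iff)

text \<open>The order of counting is free: a non-simple vertex is put first, or a nonadjacent pair
  is put first and second. Either way one vertex gains \<open>(m choose j)\<close>, and
  \<open>touch_extend\<close> counts the rest.\<close>

lemma touch_gain:
  assumes FL: "F \<in> L" and rkF: "rk F = m + 3" and S: "S \<subseteq> verts F"
    and gain: "(\<exists>v\<in>S. m + 2 < card (edges v F)) \<or> (\<exists>v\<in>S. \<exists>w\<in>S. v \<noteq> w \<and> (\<forall>A\<in>edges w F. \<not> v \<le> A))"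
  shows "((m + 3) choose Suc (Suc j)) + (m choose j)
    \<le> touch F (Suc (Suc j)) S + ((m + 3 - card S) choose Suc (Suc j))"
  using gain
proof
  assume "\<exists>v\<in>S. m + 2 < card (edges v F)"
  then obtain v where v: "v \<in> S" "m + 2 < card (edges v F)" by blast
  have vV: "v \<in> L" "v \<le> F" "rk v = 1" using v S by (auto simp: verts_iff)
  have "((m + 2) choose Suc j) + (m choose j) \<le> card (up v F (Suc j) {})"
    using nonboolean_bound[of v F m "{}" j] v(2) vV FL rkF by (simp add: edges_def)
  moreover have "touch F (Suc (Suc j)) {v} = card (up v F (Suc j) {})"
    using touch_insert[of v F "Suc j" "{}"] vV by simp
  ultimately show ?thesis
    using touch_extend[OF FL, of "m + 2" "{v}" S "Suc j"] rkF v S by (simp add: numeral_3_eq_3)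
next
  assume "\<exists>v\<in>S. \<exists>w\<in>S. v \<noteq> w \<and> (\<forall>A\<in>edges w F. \<not> v \<le> A)"
  then obtain v w where vw: "v \<in> S" "w \<in> S" "v \<noteq> w" "\<forall>A\<in>edges w F. \<not> v \<le> A" by blast
  have v: "v \<in> L" "rk v = 1" "v \<in> verts F" "{v} \<subseteq> verts F" using vw S by (auto simp: verts_iff)
  have w: "w \<in> L" "w \<le> F" "rk w = 1" "w \<in> verts F" using vw S by (auto simp: verts_iff)
  have "((m + 1) choose Suc j) + (m choose j) \<le> card (up w F (Suc j) {v})"
    using nonadjacent_bound[of w F m "{v}" v j] verts_avoid[OF w(4) v(4)] vw w FL rkF
    by (simp add: edges_def)
  moreover have "touch F (Suc (Suc j)) {v, w} = touch F (Suc (Suc j)) {v} + card (up w F (Suc j) {v})"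
    using touch_insert[of w F "Suc j" "{v}"] w by (simp add: insert_commute)
  moreover have "touch F (Suc (Suc j)) {v} = card (up v F (Suc j) {})"
    using touch_insert[of v F "Suc j" "{}"] v by simp
  moreover have "(m + 2) choose Suc j \<le> card (up v F (Suc j) {})"
    using vertex_bound[OF FL _ v(3), of "m + 2" "{}" "m + 2" "Suc j"] rkF by simp
  ultimately show ?thesis
    using touch_extend[OF FL, of "m + 2" "{v, w}" S "Suc j"] rkF vw S
    by (simp add: numeral_3_eq_3 numeral_2_eq_2)
qed

text \<open>Here every vertex gains: \<open>(d - 2 - n choose j)\<close> after \<open>n\<close>
  others. These gains telescope to
  \<open>(d - 1 choose Suc j) - (d - 1 - card S choose Suc j)\<close>.\<close>

lemma touch_nonsimple:
  assumes FL: "F \<in> L" and rkF: "rk F = Suc d"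
    and "finite S" "S \<subseteq> verts F" "\<forall>v\<in>S. d < card (edges v F)" "card S < d"
  shows "(Suc d choose Suc (Suc j)) + ((d - 1) choose Suc j)
    \<le> touch F (Suc (Suc j)) S + ((Suc d - card S) choose Suc (Suc j)) + ((d - 1 - card S) choose Suc j)"
  using assms(3-)
proof (induction S rule: finite_induct)
  case (insert v S)
  obtain m where m: "d = m + card S + 2" using insert.prems insert.hyps
    by (metis add.commute add_2_eq_Suc' card_insert_disjoint less_iff_Suc_add add_Suc_right)
  have v: "v \<in> verts F" "S \<subseteq> verts F" "v \<notin> S" using insert by auto
  then have "((m + 2) choose Suc j) + (m choose j) \<le> card (up v F (Suc j) S)"
    using nonboolean_bound[of v F m S j] insert.prems verts_avoid[OF v] FL rkF m
    by (simp add: edges_def verts_iff)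
  moreover have "touch F (Suc (Suc j)) (insert v S) = touch F (Suc (Suc j)) S + card (up v F (Suc j) S)"
    using v by (intro touch_insert) (auto simp: verts_iff)
  ultimately show ?case using insert m by (simp add: numeral_3_eq_3)
qed simp

text \<open>With \<open>v\<close> counted first, every \<open>w\<close> in \<open>S\<close> is
  nonadjacent to an earlier vertex; the gains are those of \<open>touch_nonsimple\<close>.\<close>

lemma touch_star:
  assumes FL: "F \<in> L" and rkF: "rk F = Suc d" and v: "v \<in> verts F" and "finite S"
    "S \<subseteq> verts F" "v \<notin> S" "\<forall>w\<in>S. \<forall>A\<in>edges w F. \<not> v \<le> A" "card S < d"
  shows "(Suc d choose Suc (Suc j)) + ((d - 1) choose Suc j)
    \<le> touch F (Suc (Suc j)) (insert v S) + ((d - card S) choose Suc (Suc j)) + ((d - 1 - card S) choose Suc j)"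
  using assms(4-)
proof (induction S rule: finite_induct)
  case empty
  have "touch F (Suc (Suc j)) {v} = card (up v F (Suc j) {})"
    using touch_insert[of v F "Suc j" "{}"] v by (simp add: verts_iff)
  moreover have "d choose Suc j \<le> card (up v F (Suc j) {})"
    using vertex_bound[OF FL rkF v, of "{}" d] by simp
  ultimately show ?case by simp
next
  case (insert w S)
  obtain m where m: "d = m + card S + 2" using insert.prems insert.hyps
    by (metis add.commute add_2_eq_Suc' card_insert_disjoint less_iff_Suc_add add_Suc_right)
  let ?S = "insert v S"
  have c: "card ?S = Suc (card S)" using insert by simp
  have w: "w \<in> verts F" "?S \<subseteq> verts F" "w \<notin> ?S" using insert v by auto
  then have "((m + 1) choose Suc j) + (m choose j) \<le> card (up w F (Suc j) ?S)"
    using nonadjacent_bound[of w F m ?S v j] insert.prems verts_avoid[OF w] FL rkF m c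
    by (simp add: edges_def verts_iff)
  moreover have "touch F (Suc (Suc j)) (insert w ?S) = touch F (Suc (Suc j)) ?S + card (up w F (Suc j) ?S)"
    using w by (intro touch_insert) (auto simp: verts_iff)
  ultimately show ?case using insert m by (simp add: insert_commute)
qed

lemma edge_vertices:
  assumes "A \<in> edges v F" "rk v = 1" "{x, y, z} \<subseteq> verts A"
  shows "x = y \<or> y = z \<or> x = z"
proof (rule ccontr)
  assume ne: "\<not> ?thesis"
  have A: "A \<in> L" "rk A = 2" using assms by (auto simp: edges_iff)
  have "{v\<in>L. v \<le> A \<and> rk v = 1} = verts A" by (auto simp: verts_iff)
  then have "card (verts A) \<le> 2" using edge[OF A] by simp
  moreover have "card {x, y, z} \<le> card (verts A)" using assms(3) by (intro card_mono) auto
  ultimately show False using ne by simp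
qed

lemma edges_sym:
  assumes "v \<in> verts F" "w \<in> verts F" "A \<in> edges v F" "w \<le> A"
  shows "A \<in> edges w F"
  using assms by (auto simp: edges_iff verts_iff)

text \<open>If there is a simple vertex \<open>v\<close>, cross the ridge opposite to \<open>v\<close> in a facet through \<open>v\<close>: the
  facet \<open>G\<close> on the other side contains all but at most one of the neighbours of \<open>v\<close>, so almost all
  vertices outside \<open>G\<close> are nonadjacent to \<open>v\<close>.\<close>

lemma simplicial_bound:
  assumes FL: "F \<in> L" and rkF: "rk F = Suc d" and fac: "\<And>G. G \<in> up bot F d {} \<Longrightarrow> card (verts G) = d"
    and cF: "card (verts F) = d + s" and s: "3 \<le> s"
  shows "(Suc d choose Suc (Suc j)) + (d choose Suc (Suc j)) + ((d - 1) choose Suc j)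
    \<le> card (up bot F (Suc (Suc j)) {}) + ((d + 1 - s) choose Suc (Suc j)) + ((d + 1 - s) choose Suc j)"
proof -
  \<comment> \<open>The cap ensures \<open>r - 2 < d\<close>, so that \<open>r - 2\<close> vertices
    can be given gains, and leaves \<open>d + 1 - s\<close> unchanged under truncation.\<close>
  define r where "r = min s (d + 1)"
  have d1: "1 \<le> d"
  proof (rule ccontr)
    assume "\<not> 1 \<le> d"
    then have "verts F \<subseteq> {F}" using rk_eq_imp_eq FL rkF by (auto simp: verts_iff)
    then show False using card_mono[of "{F}" "verts F"] cF s by simp
  qed
  have Fbot: "bot < F" using rkF rk_bot by (metis bot.not_eq_extremum nat.distinct(1))
  have r: "2 \<le> r" "r \<le> s" "r \<le> d + 1" "d + 1 - r = d + 1 - s" using s d1 by (auto simp: r_def)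
  \<comment> \<open>It suffices to realise the gains on some set \<open>T\<close> of vertices
    outside a facet \<open>G\<close>: \<open>touch_extend\<close> adds the other outside vertices,
    and \<open>G\<close> has at least the faces of a simplex.\<close>
  have combine: ?thesis
    if G: "G \<in> up bot F d {}" and T: "T \<subseteq> {v\<in>verts F. \<not> v \<le> G}"
      and le: "(Suc d choose Suc (Suc j)) + ((d - 1) choose Suc j)
        \<le> touch F (Suc (Suc j)) T + ((d + 1 - card T) choose Suc (Suc j)) + ((d + 1 - r) choose Suc j)" for G T
  proof -
    have G': "G \<in> L" "G \<le> F" "rk G = d" using G by (auto simp: faces_iff)
    let ?W = "{v\<in>verts F. \<not> v \<le> G}"
    have "card ?W = s" using facet_split[OF FL G'(1,2)] cF fac[OF G] by simp
    then have "touch F (Suc (Suc j)) T + ((d + 1 - card T) choose Suc (Suc j))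
        \<le> touch F (Suc (Suc j)) ?W + ((d + 1 - s) choose Suc (Suc j))"
      using touch_extend[OF FL rkF T, of "Suc j"] by auto
    moreover have "card (up bot G (Suc (Suc j)) {}) + touch F (Suc (Suc j)) ?W \<le> card (up bot F (Suc (Suc j)) {})"
      using touch_facet[OF G'(2), of ?W] by simp
    moreover have "d choose Suc (Suc j) \<le> card (up bot G (Suc (Suc j)) {})"
      using boolean_bound[OF bot_L G'(1) bot_least, of "Suc (Suc j)"] G' by (simp add: rk_bot)
    ultimately show ?thesis using le unfolding r(4) by linarith
  qed
  show ?thesis
  proof (cases "\<exists>v\<in>verts F. card (edges v F) \<le> d")
    case False
    obtain G where G: "G \<in> L" "G < F" "rk F = Suc (rk G)"
      by (rule facet_containing[OF bot_L FL Fbot])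
    have GF: "G \<in> up bot F d {}" using G rkF by (simp add: faces_iff)
    let ?W = "{v\<in>verts F. \<not> v \<le> G}"
    have "card ?W = s" using facet_split[OF FL G(1)] G(2) cF fac[OF GF] by simp
    then have "r - 2 \<le> card ?W" using r by simp
    then obtain T where T: "T \<subseteq> ?W" "card T = r - 2" "finite T" by (rule obtain_subset_with_card_n)
    have TV: "T \<subseteq> verts F" using T by auto
    have fT: "finite T" by (rule finite_subset[OF TV finite_verts])
    have "(Suc d choose Suc (Suc j)) + ((d - 1) choose Suc j)
        \<le> touch F (Suc (Suc j)) T + ((Suc d - card T) choose Suc (Suc j)) + ((d - 1 - card T) choose Suc j)"
    proof (rule touch_nonsimple[OF FL rkF fT TV])
      show "\<forall>v\<in>T. d < card (edges v F)" using False TV by (auto simp: not_le)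
      show "card T < d" using T(2) r(2,3) d1 by linarith
    qed
    moreover have "d - 1 - card T = d + 1 - r" using T(2) r by simp
    ultimately show ?thesis using combine[OF GF T(1)] by simp
  next
    case True
    then obtain v where v: "v \<in> verts F" "card (edges v F) \<le> d" by blast
    have vL: "v \<in> L" "v \<le> F" "rk v = 1" using v by (auto simp: verts_iff)
    have "v < F" using vL rkF d1 by (cases "v = F") auto
    obtain H where H: "H \<in> L" "v \<le> H" "H < F" "rk F = Suc (rk H)"
      by (rule facet_containing[OF vL(1) FL \<open>v < F\<close>])
    have "bot < H" "\<not> v \<le> bot" using vL H rk_bot by (auto simp: bot.not_eq_extremum[symmetric] bot_unique)
    then obtain R where R: "R \<in> L" "R < H" "rk H = Suc (rk R)" "\<not> v \<le> R"
      using facet_avoiding[OF bot_L H(1)] by metis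
    have "R < F" using R H by simp
    obtain G where G: "G \<in> L" "R \<le> G" "G < F" "rk F = Suc (rk G)" "\<not> v \<le> G"
      by (rule facet_avoiding[OF R(1) FL \<open>R < F\<close> R(4)])
    have GF: "G \<in> up bot F d {}" using G rkF by (simp add: faces_iff)
    have HF: "H \<in> up bot F d {}" using H rkF by (simp add: faces_iff)
    let ?W = "{v\<in>verts F. \<not> v \<le> G}"
    \<comment> \<open>The neighbours of \<open>v\<close> outside \<open>G\<close>. As
      \<open>verts H\<close> is \<open>verts R\<close> with \<open>v\<close> added, none of them
      lies in \<open>H\<close>, so their edges to \<open>v\<close> leave \<open>H\<close>; at most
      one edge at \<open>v\<close> does.\<close>
    define X where "X = {w\<in>?W. w \<noteq> v \<and> (\<exists>A\<in>edges w F. v \<le> A)}"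
    have cW: "card ?W = s" using facet_split[OF FL G(1)] G(3) cF fac[OF GF] by simp
    have "verts R \<subseteq> verts H - {v}" using R by (auto simp: verts_iff)
    moreover have "card (verts H - {v}) = d - 1" using fac[OF HF] vL H by (simp add: verts_iff)
    moreover have "d - 1 \<le> card (verts R)" using verts_card_ge[OF R(1)] R H rkF by simp
    ultimately have vR: "verts R = verts H - {v}"
      by (intro card_seteq) auto
    have notH: "\<not> w \<le> H" if "w \<in> X" for w
    proof
      assume "w \<le> H"
      then have "w \<in> verts R" using vR that by (auto simp: X_def verts_iff)
      then show False using that G by (auto simp: X_def verts_iff)
    qed
    have eH: "edges v H \<subseteq> edges v F" using H by (auto simp: edges_iff)
    have "d - 1 \<le> card (edges v H)" using edges_card_ge[OF H(1), of v "d - 1"] H vL rkF d1 by (simp add: verts_iff)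
    then have e1: "card (edges v F - edges v H) \<le> 1"
      using v(2) card_Diff_subset[OF finite_edges eH] by simp
    have "card X \<le> 1"
    proof (rule ccontr)
      assume "\<not> card X \<le> 1"
      then have "2 \<le> card X" by simp
      then obtain Y where "Y \<subseteq> X" "card Y = 2" "finite Y" by (rule obtain_subset_with_card_n)
      then obtain a b where ab: "a \<in> X" "b \<in> X" "a \<noteq> b" by (auto simp: card_2_iff)
      obtain A B where AB: "A \<in> edges a F" "v \<le> A" "B \<in> edges b F" "v \<le> B"
        using ab by (auto simp: X_def)
      have aV: "a \<in> verts F" "a \<noteq> v" "b \<in> verts F" "b \<noteq> v" using ab by (auto simp: X_def)
      have Av: "A \<in> edges v F" "B \<in> edges v F"
        using edges_sym[OF aV(1) v(1) AB(1,2)] edges_sym[OF aV(3) v(1) AB(3,4)] by auto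
      have "a \<le> A" "b \<le> B" using AB by (auto simp: edges_iff)
      then have "\<not> A \<le> H" "\<not> B \<le> H"
        using notH[OF ab(1)] notH[OF ab(2)] order_trans[of a A H] order_trans[of b B H] by auto
      then have "{A, B} \<subseteq> edges v F - edges v H" using Av by (auto simp: edges_iff)
      then have "card {A, B} \<le> 1" using e1 card_mono[of "edges v F - edges v H" "{A, B}"] by simp
      then have "A = B" by (cases "A = B") auto
      then have "{v, a, b} \<subseteq> verts A" using AB(2) aV v \<open>a \<le> A\<close> \<open>b \<le> B\<close> by (auto simp: verts_iff)
      then show False using edge_vertices[OF Av(1) vL(3)] aV(2,4) ab(3) by metis
    qed
    let ?Q = "?W - {v} - X"
    have vW: "v \<in> ?W" using v G by simp
    have "card ?W \<le> card ({v} \<union> X \<union> ?Q)" by (intro card_mono) (auto simp: X_def)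
    also have "\<dots> \<le> card ({v} \<union> X) + card ?Q" by (rule card_Un_le)
    also have "\<dots> \<le> card {v} + card X + card ?Q" using card_Un_le[of "{v}" X] by simp
    \<comment> \<open>Only \<open>v\<close> and at most one neighbour are discarded from the
      \<open>s\<close> outside vertices.\<close>
    finally have "r - 2 \<le> card ?Q" using cW \<open>card X \<le> 1\<close> r by simp
    then obtain T where T: "T \<subseteq> ?Q" "card T = r - 2" "finite T" by (rule obtain_subset_with_card_n)
    have TV: "T \<subseteq> verts F" using T by auto
    have fT: "finite T" by (rule finite_subset[OF TV finite_verts])
    have vT: "v \<notin> T" using T by auto
    have "(Suc d choose Suc (Suc j)) + ((d - 1) choose Suc j)
      \<le> touch F (Suc (Suc j)) (insert v T) + ((d - card T) choose Suc (Suc j)) + ((d - 1 - card T) choose Suc j)"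
      using TV T r d1 by (intro touch_star[OF FL rkF v(1) fT TV vT]) (auto simp: X_def)
    moreover have "d - 1 - card T = d + 1 - r" using T(2) r by simp
    moreover have "d - card T = d + 1 - card (insert v T)" using fT vT by simp
    ultimately show ?thesis using combine[OF GF, of "insert v T"] T(1) vW by auto
  qed
qed

section \<open>Polytopes with many facets\<close>

text \<open>\<open>F\<close> is a pyramid over \<open>G\<close> with apex \<open>v\<close>. A facet
  \<open>R\<close> of \<open>G\<close> is \<open>inf G H\<close> for another facet \<open>H\<close>
  of \<open>F\<close>, and \<open>verts H = insert v (verts R)\<close>. So the alternative for
  \<open>H\<close> is the one for \<open>R\<close>, shifted by one vertex.\<close>

lemma pyramid_base:
  assumes FL: "F \<in> L" and rkF: "rk F = Suc (Suc e)" and G: "G \<in> up bot F (Suc e) {}"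
    and c: "Suc (card (verts G)) = card (verts F)"
    and cls: "\<And>H. H \<in> up bot F (Suc e) {} \<Longrightarrow> card (verts H) = Suc e \<or> Suc (card (verts H)) = card (verts F)"
    and R: "R \<in> up bot G e {}"
  shows "card (verts R) = e \<or> Suc (card (verts R)) = card (verts G)"
proof -
  have G': "G \<in> L" "G \<le> F" "rk G = Suc e" using G by (auto simp: faces_iff)
  have R': "R \<in> L" "R \<le> G" "rk R = e" using R by (auto simp: faces_iff)
  have sub: "verts G \<subseteq> verts F" using G' by (simp add: verts_mono)
  have "card (verts F - verts G) = 1"
    using c by (subst card_Diff_subset[OF finite_verts sub]) simp
  then obtain v where v: "verts F - verts G = {v}" by (auto simp: card_1_singleton_iff)
  have "R < F" using R' G' rkF by (cases "R = F") auto
  have "\<not> G \<le> R" using R' G' rk_mono[of G R] by auto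
  obtain H where H: "H \<in> L" "R \<le> H" "H < F" "rk F = Suc (rk H)" "\<not> G \<le> H"
    by (rule facet_avoiding[OF R'(1) FL \<open>R < F\<close> \<open>\<not> G \<le> R\<close>])
  have HF: "H \<in> up bot F (Suc e) {}" using H rkF by (simp add: faces_iff)
  have i: "inf G H \<in> L" using inf_L G' H by simp
  have "rk (inf G H) < rk G" using rk_less[OF i G'(1)] H by (simp add: inf_less_iff)
  then have "R = inf G H" using rk_eq_imp_eq[OF R'(1) i] R' H G' by simp
  then have vR: "verts R = verts G \<inter> verts H" by (auto simp: verts_iff)
  have subH: "verts H \<subseteq> verts F" using H by (simp add: verts_mono)
  have "\<not> H \<le> G"
  proof
    assume "H \<le> G"
    then show False using rk_eq_imp_eq[OF H(1) G'(1)] H G' rkF by auto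
  qed
  then have "\<not> verts H \<subseteq> verts G" using verts_subset_iff[OF H(1) G'(1)] by simp
  then have vH: "v \<in> verts H" using v subH by auto
  have vG: "v \<notin> verts G" using v by auto
  have "verts H = insert v (verts R)" using v vH vR subH by auto
  moreover have "v \<notin> verts R" using vG vR by auto
  ultimately have "card (verts H) = Suc (card (verts R))" by simp
  then show ?thesis using cls[OF HF] c by auto
qed

text \<open>Either all facets are simplices, or \<open>F\<close> is a pyramid over a facet of the
  same kind. Then two consecutive instances for the base add up by Pascal's rule.\<close>

lemma pyramidal_bound:
  assumes "F \<in> L" "rk F = Suc d"
    and "\<And>G. G \<in> up bot F d {} \<Longrightarrow> card (verts G) = d \<or> Suc (card (verts G)) = card (verts F)"
    and "card (verts F) = d + s" "3 \<le> s"
  shows "(Suc d choose Suc (Suc j)) + (d choose Suc (Suc j)) + ((d - 1) choose Suc j)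
    \<le> card (up bot F (Suc (Suc j)) {}) + ((d + 1 - s) choose Suc (Suc j)) + ((d + 1 - s) choose Suc j)"
  using assms
proof (induction d arbitrary: F j)
  case 0
  then have "verts F \<subseteq> {F}" using rk_eq_imp_eq by (auto simp: verts_iff)
  then show ?case using card_mono[of "{F}" "verts F"] 0 by simp
next
  case (Suc e)
  note FL = Suc.prems(1) and rkF = Suc.prems(2) and cls = Suc.prems(3) and cF = Suc.prems(4)
  show ?case
  proof (cases "\<forall>G\<in>up bot F (Suc e) {}. card (verts G) = Suc e")
    case True
    then show ?thesis using simplicial_bound[OF FL rkF _ cF] Suc.prems(5) by blast
  next
    case False
    then obtain G where G: "G \<in> up bot F (Suc e) {}" "Suc (card (verts G)) = card (verts F)"
      using cls by blast
    then have G': "G \<in> L" "G \<le> F" "rk G = Suc e" by (auto simp: faces_iff)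
    have cG: "card (verts G) = e + s" using G cF by simp
    have IH: "(Suc e choose Suc (Suc i)) + (e choose Suc (Suc i)) + ((e - 1) choose Suc i)
      \<le> card (up bot G (Suc (Suc i)) {}) + ((e + 1 - s) choose Suc (Suc i)) + ((e + 1 - s) choose Suc i)" for i
      using Suc.IH[OF G'(1,3) pyramid_base[OF FL rkF G cls] cG Suc.prems(5)] by simp
    have e0: "e \<noteq> 0"
    proof
      assume "e = 0"
      then have "verts G \<subseteq> {G}" using rk_eq_imp_eq G' by (auto simp: verts_iff)
      then show False using card_mono[of "{G}" "verts G"] cG Suc.prems(5) by simp
    qed
    then obtain n where n: "e = Suc n" by (cases e) auto
    have "G < F" using G' rkF by (cases "G = F") auto
    then have ext: "card (up bot G (Suc (Suc j)) {}) + card (up bot G (Suc j) {}) \<le> card (up bot F (Suc (Suc j)) {})"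
      using facet_extend[OF bot_L FL G'(1) bot_least] by simp
    show ?thesis
    \<comment> \<open>For \<open>j = 0\<close> the lower instance is replaced by the exact number
      \<open>e + s\<close> of vertices of \<open>G\<close>.\<close>
    proof (cases j)
      case 0
      have "card (up bot G (Suc 0) {}) = e + s" using cG by (simp add: verts_def)
      then show ?thesis
        using IH[of 0] ext 0 n by (cases "s \<le> e + 1") (auto simp: Suc_diff_le numeral_2_eq_2)
    next
      case (Suc i)
      then show ?thesis
        using IH[of i] IH[of j] ext n by (cases "s \<le> e + 1") (auto simp: Suc_diff_le)
    qed
  qed
qed

section \<open>Facets through simple vertices\<close>

text \<open>\<open>H\<close> has at least \<open>d - 1\<close> of the at most \<open>d\<close> edges
  at \<open>w\<close>, and some edge at \<open>w\<close> leaves \<open>H\<close> because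
  \<open>F\<close> is not below \<open>H\<close>.\<close>

lemma simple_vertex_missed_edge:
  assumes FL: "F \<in> L" and rkF: "rk F = Suc d" and w: "w \<in> verts F" "card (edges w F) \<le> d"
    and H: "H \<in> up bot F d {}" "w \<le> H"
  obtains A where "edges w F - edges w H = {A}"
proof -
  have H': "H \<in> L" "H \<le> F" "rk H = d" using H by (auto simp: faces_iff)
  have wL: "w \<in> L" "w \<le> F" "rk w = 1" using w by (auto simp: verts_iff)
  obtain e where e: "d = Suc e" using rk_mono[OF wL(1) H'(1) H(2)] wL H' by (cases d) auto
  have sub: "edges w H \<subseteq> edges w F" using H' by (auto simp: edges_iff)
  have "e \<le> card (edges w H)" using edges_card_ge[OF H'(1)] wL H H' e by (simp add: verts_iff)
  then have "card (edges w F - edges w H) \<le> 1"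
    using w(2) e by (subst card_Diff_subset[OF finite_edges sub]) simp
  moreover have "\<not> F \<le> H" using rk_mono[OF FL H'(1)] H' rkF by auto
  then obtain A where "A \<in> up w F 1 {}" "\<not> A \<le> H"
    by (rule up_atom[OF wL(1) FL H'(1) wL(2) H(2)])
  then have A: "A \<in> edges w F - edges w H" unfolding edges_def by (auto simp: up_def)
  ultimately have "edges w F - edges w H = {A}"
    using card_seteq[of "edges w F - edges w H" "{A}"] by auto
  then show thesis by (rule that)
qed

lemma simple_vertex_facet_unique:
  assumes FL: "F \<in> L" and w: "w \<in> verts F"
    and H: "H \<in> up bot F d {}" "w \<le> H" and H': "H' \<in> up bot F d {}" "w \<le> H'"
    and eq: "edges w F - edges w H = edges w F - edges w H'"
  shows "H = H'"
proof -
  have HL: "H \<in> L" "H \<le> F" "rk H = d" "H' \<in> L" "H' \<le> F" "rk H' = d" using H H' by (auto simp: faces_iff)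
  have wL: "w \<in> L" using w by (auto simp: verts_iff)
  have "H \<le> H'"
  proof (rule ccontr)
    assume "\<not> H \<le> H'"
    then obtain A where A: "A \<in> up w H 1 {}" "\<not> A \<le> H'"
      by (rule up_atom[OF wL HL(1,4) H(2) H'(2)])
    then have "A \<in> edges w H" "A \<notin> edges w H'" "A \<in> edges w F"
      using HL by (auto simp: edges_iff up_def)
    then show False using eq by blast
  qed
  then show ?thesis using rk_eq_imp_eq HL by simp
qed

text \<open>A facet through \<open>w\<close> is determined by its edges at \<open>w\<close>, hence
  by the one it omits; so these facets inject into the edges at \<open>w\<close>.\<close>

lemma simple_vertex_facets:
  assumes FL: "F \<in> L" and rkF: "rk F = Suc d" and w: "w \<in> verts F" "card (edges w F) \<le> d"
  shows "card {H\<in>up bot F d {}. w \<le> H} \<le> d"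
proof -
  define h where "h H = (THE A. edges w F - edges w H = {A})" for H
  have h: "edges w F - edges w H = {h H}" if H: "H \<in> up bot F d {}" "w \<le> H" for H
  proof -
    obtain A where "edges w F - edges w H = {A}"
      by (rule simple_vertex_missed_edge[OF FL rkF w H])
    then show ?thesis unfolding h_def by simp
  qed
  have "inj_on h {H\<in>up bot F d {}. w \<le> H}"
  proof (rule inj_onI)
    fix H H' assume a: "H \<in> {H\<in>up bot F d {}. w \<le> H}" "H' \<in> {H\<in>up bot F d {}. w \<le> H}" "h H = h H'"
    then have "edges w F - edges w H = edges w F - edges w H'" using h by simp
    then show "H = H'" using simple_vertex_facet_unique[OF FL w(1)] a by blast
  qed
  moreover have "h ` {H\<in>up bot F d {}. w \<le> H} \<subseteq> edges w F" using h by blast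
  ultimately have "card {H\<in>up bot F d {}. w \<le> H} \<le> card (edges w F)"
    by (intro card_inj_on_le) auto
  then show ?thesis using w by simp
qed

text \<open>A facet through a simple vertex omits exactly one edge there. Hence a facet missing \<open>w\<close> but
  meeting the clique \<open>W\<close> contains \<open>W - {w}\<close>, and there is at most one such facet.\<close>

lemma simple_clique_facets:
  assumes FL: "F \<in> L" and rkF: "rk F = Suc d" and G: "G \<in> up bot F d {}"
    and W: "W = {v\<in>verts F. \<not> v \<le> G}"
    and simple: "\<And>v. v \<in> W \<Longrightarrow> card (edges v F) \<le> d"
    and adj: "\<And>v w. v \<in> W \<Longrightarrow> w \<in> W \<Longrightarrow> v \<noteq> w \<Longrightarrow> \<exists>A\<in>edges w F. v \<le> A"
  shows "card (up bot F d {}) \<le> d + 2"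
proof -
  have G': "G \<in> L" "G \<le> F" "rk G = d" using G by (auto simp: faces_iff)
  have "\<not> F \<le> G" using rk_mono[OF FL G'(1)] G' rkF by auto
  then have "\<not> verts F \<subseteq> verts G" using verts_subset_iff FL G' by simp
  then obtain w where "w \<in> verts F" "w \<notin> verts G" by (auto simp: subset_iff)
  then have w: "w \<in> W" unfolding W by (simp add: verts_iff)
  have wV: "w \<in> verts F" using w W by simp
  have meets: "\<exists>v\<in>W. v \<le> H" if H: "H \<in> up bot F d {}" "H \<noteq> G" for H
  proof (rule ccontr)
    have HL: "H \<in> L" "H \<le> F" "rk H = d" using H by (auto simp: faces_iff)
    assume "\<not> ?thesis"
    then have "x \<le> G" if "x \<in> verts H" for x
      using that HL(2) verts_mono[of H F] unfolding W by (auto simp: verts_iff)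
    then have "verts H \<subseteq> verts G" by (auto simp: verts_iff)
    then have "H \<le> G" using verts_subset_iff HL G' by simp
    then show False using rk_eq_imp_eq HL G' H by simp
  qed
  \<comment> \<open>The edge from \<open>v\<close> to \<open>w\<close> is not in \<open>H\<close>,
    so it is the one edge that \<open>H\<close> omits at \<open>v\<close>.\<close>
  have miss: "edges v F - edges v H = {A}"
    if H: "H \<in> up bot F d {}" "\<not> w \<le> H" "v \<in> W" "v \<le> H" and A: "A \<in> edges v F" "w \<le> A" for H v A
  proof -
    have vV: "v \<in> verts F" "card (edges v F) \<le> d" using H W simple by auto
    obtain B where B: "edges v F - edges v H = {B}"
      by (rule simple_vertex_missed_edge[OF FL rkF vV H(1,4)])
    have "A \<notin> edges v H" using H(2) A(2) order_trans by (auto simp: edges_iff)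
    then show ?thesis using A B by auto
  qed
  have all: "u \<le> H" if H: "H \<in> up bot F d {}" "\<not> w \<le> H" "v \<in> W" "v \<le> H" and u: "u \<in> W" "u \<noteq> w" for H v u
  proof (cases "u = v")
    case False
    have vw: "v \<noteq> w" using H by auto
    obtain A where A: "A \<in> edges v F" "w \<le> A" using adj[OF w H(3)] vw by auto
    obtain B where B: "B \<in> edges v F" "u \<le> B" using adj[OF u(1) H(3)] False by auto
    have V: "rk v = 1" "v \<in> L" "u \<in> L" "rk u = 1" "w \<in> L" "rk w = 1" using H u w W by (auto simp: verts_iff)
    have "A \<noteq> B"
    proof
      assume "A = B"
      then have "{u, v, w} \<subseteq> verts A" using A B V by (auto simp: verts_iff edges_iff)
      then show False using edge_vertices[OF A(1) V(1)] False vw u(2) by metis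
    qed
    then have "B \<in> edges v H" using miss[OF H A] B by auto
    then show ?thesis using B by (auto simp: edges_iff)
  qed (use H in simp)
  have uniq: "H = H'"
    if H: "H \<in> up bot F d {}" "\<not> w \<le> H" "H \<noteq> G" and H': "H' \<in> up bot F d {}" "\<not> w \<le> H'" "H' \<noteq> G" for H H'
  proof -
    obtain v where v: "v \<in> W" "v \<le> H" using meets H by blast
    obtain v' where v': "v' \<in> W" "v' \<le> H'" using meets H' by blast
    have vw: "v \<noteq> w" using v H by auto
    have vH': "v \<le> H'" using all[OF H'(1,2) v' v(1) vw] .
    obtain A where A: "A \<in> edges v F" "w \<le> A" using adj[OF w v(1)] vw by auto
    have "edges v F - edges v H = edges v F - edges v H'"
      using miss[OF H(1,2) v A] miss[OF H'(1,2) v(1) vH' A] by simp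
    then show ?thesis using simple_vertex_facet_unique[OF FL _ H(1) v(2) H'(1) vH'] v W by simp
  qed
  \<comment> \<open>At most \<open>d\<close> facets contain \<open>w\<close>; besides
    \<open>G\<close>, at most one facet does not.\<close>
  let ?A = "{H\<in>up bot F d {}. w \<le> H}" and ?B = "{H\<in>up bot F d {}. \<not> w \<le> H \<and> H \<noteq> G}"
  have "card ?B \<le> 1" using uniq by (intro card_le_Suc0_iff_eq[THEN iffD2, unfolded One_nat_def[symmetric]]) auto
  moreover have "card ?A \<le> d" by (rule simple_vertex_facets[OF FL rkF wV simple[OF w]])
  moreover have "card (up bot F d {}) \<le> card (insert G (?A \<union> ?B))" by (intro card_mono) auto
  moreover have "card (insert G (?A \<union> ?B)) \<le> Suc (card (?A \<union> ?B))" by (rule card_insert_le_m1) auto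
  moreover have "card (?A \<union> ?B) \<le> card ?A + card ?B" by (rule card_Un_le)
  ultimately show ?thesis by linarith
qed

section \<open>Extra faces outside a facet\<close>

lemma inf_extend:
  assumes "K \<in> up bot G k {}" "G \<in> L" "A \<in> up K F 1 {}" "\<not> A \<le> G"
  shows "inf A G = K"
  using inf_atom[of K G A F] assms by (auto simp: faces_iff)

text \<open>An extension \<open>A\<close> of \<open>K\<close> recovers \<open>K\<close> as
  \<open>inf A G\<close>, so extensions of different faces differ and each face in \<open>D\<close>
  may be counted twice.\<close>

lemma extend_twice:
  assumes FL: "F \<in> L" and GL: "G \<in> L" and lt: "G < F" and D: "D \<subseteq> up bot G k {}"
    and two: "\<And>K. K \<in> D \<Longrightarrow> \<exists>A B. A \<noteq> B \<and> A \<in> up K F 1 {} \<and> B \<in> up K F 1 {} \<and> \<not> A \<le> G \<and> \<not> B \<le> G"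
  shows "card (up bot G k {}) + card D \<le> card {A\<in>up bot F (Suc k) {}. \<not> A \<le> G \<and> rk (inf A G) = k}"
proof -
  have ex: "\<exists>A B. A \<in> up K F 1 {} \<and> \<not> A \<le> G \<and> (K \<in> D \<longrightarrow> A \<noteq> B \<and> B \<in> up K F 1 {} \<and> \<not> B \<le> G)"
    if K: "K \<in> up bot G k {}" for K
  proof (cases "K \<in> D")
    case False
    have K': "K \<in> L" "K \<le> F" "K \<le> G" "\<not> F \<le> G" using K lt by (auto simp: faces_iff)
    obtain A where "A \<in> up K F 1 {}" "\<not> A \<le> G"
      by (rule up_atom[OF K'(1) FL GL K'(2-4)])
    then show ?thesis using False by blast
  qed (use two in blast)
  define P where "P K A B \<longleftrightarrow> A \<in> up K F 1 {} \<and> \<not> A \<le> G \<and>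
    (K \<in> D \<longrightarrow> A \<noteq> B \<and> B \<in> up K F 1 {} \<and> \<not> B \<le> G)" for K A B
  have "\<forall>K\<in>up bot G k {}. \<exists>p. P K (fst p) (snd p)" using ex unfolding P_def by simp
  from bchoice[OF this] obtain h where h: "\<And>K. K \<in> up bot G k {} \<Longrightarrow> P K (fst (h K)) (snd (h K))" by blast
  define f where "f K = fst (h K)" for K
  define g where "g K = snd (h K)" for K
  have f: "f K \<in> up K F 1 {} \<and> \<not> f K \<le> G" if "K \<in> up bot G k {}" for K
    using h[OF that] unfolding P_def f_def by blast
  have g: "f K \<noteq> g K \<and> g K \<in> up K F 1 {} \<and> \<not> g K \<le> G" if "K \<in> D" for K
    using h[of K] that D unfolding P_def f_def g_def by blast
  have fK: "inf (f K) G = K" if "K \<in> up bot G k {}" for K using f[OF that] inf_extend[OF that GL] by blast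
  have gK: "inf (g K) G = K" if "K \<in> D" for K using g[OF that] inf_extend[OF subsetD[OF D that] GL] by blast
  let ?B = "{A\<in>up bot F (Suc k) {}. \<not> A \<le> G \<and> rk (inf A G) = k}"
  have "inj_on f (up bot G k {})" using fK by (metis inj_onI)
  moreover have "inj_on g D" using gK by (metis inj_onI)
  moreover have "f ` up bot G k {} \<inter> g ` D = {}"
  proof (rule ccontr)
    assume "\<not> ?thesis"
    then obtain K K' where "K \<in> up bot G k {}" "K' \<in> D" "f K = g K'" by blast
    then have "K = K'" using fK[of K] gK[of K'] by simp
    then show False using g[of K'] \<open>f K = g K'\<close> \<open>K' \<in> D\<close> by simp
  qed
  moreover have "f ` up bot G k {} \<subseteq> ?B"
  proof (rule image_subsetI)
    fix K assume K: "K \<in> up bot G k {}"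
    then show "f K \<in> ?B" using f[OF K] fK[OF K] by (auto simp: up_def rk_bot)
  qed
  moreover have "g ` D \<subseteq> ?B"
  proof (rule image_subsetI)
    fix K assume K: "K \<in> D"
    then have "K \<in> up bot G k {}" using D by blast
    then show "g K \<in> ?B" using g[OF K] gK[OF K] by (auto simp: up_def rk_bot)
  qed
  moreover have "finite D" by (rule finite_subset[OF D finite_up])
  ultimately have "card (up bot G k {}) + card D = card (f ` up bot G k {} \<union> g ` D)"
    by (simp add: card_Un_disjoint card_image)
  also have "\<dots> \<le> card ?B"
    using \<open>f ` up bot G k {} \<subseteq> ?B\<close> \<open>g ` D \<subseteq> ?B\<close> by (intro card_mono) auto
  finally show ?thesis .
qed

text \<open>The axioms of \<open>face_lattice\<close> leave room for a third facet through a ridge.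
  As \<open>J\<close> and \<open>J'\<close> meet only in \<open>R\<close>, each face of
  \<open>R\<close> has two different extensions outside \<open>G\<close>, one in \<open>J\<close>
  and one in \<open>J'\<close>.\<close>

lemma shared_ridge_bound:
  assumes FL: "F \<in> L" and rkF: "rk F = Suc (Suc e)" and G: "G \<in> up bot F (Suc e) {}"
    and J: "J \<in> up bot F (Suc e) {}" and J': "J' \<in> up bot F (Suc e) {}" and ne: "J \<noteq> J'"
    and R: "inf J G = R" "inf J' G = R" "rk R = e"
  shows "card (up bot G (Suc k) {}) + card (up bot G k {}) + (e choose k) \<le> card (up bot F (Suc k) {})"
proof -
  have L: "G \<in> L" "J \<in> L" "J' \<in> L" "G \<le> F" "J \<le> F" "J' \<le> F" "rk G = Suc e" "rk J = Suc e" "rk J' = Suc e"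
    using G J J' by (auto simp: faces_iff)
  have lt: "G < F" using L rkF by (cases "G = F") auto
  have RL: "R \<in> L" using inf_L[OF L(2,1)] R by simp
  have Rle: "R \<le> G" "R \<le> J" "R \<le> J'" using R(1,2) by (metis inf.cobounded1 inf.cobounded2)+
  have nle: "\<not> J \<le> R" "\<not> J' \<le> R" using rk_mono[OF L(2) RL] rk_mono[OF L(3) RL] L R by auto
  have JJ: "inf J J' = R"
  proof -
    have i: "inf J J' \<in> L" using inf_L L by simp
    have "\<not> J \<le> J'" using rk_eq_imp_eq[OF L(2,3)] L ne by auto
    then have "rk (inf J J') < rk J" using rk_less[OF i L(2)] by (simp add: inf_less_iff)
    then show ?thesis using rk_eq_imp_eq[OF RL i] Rle L R by simp
  qed
  have two: "\<exists>A B. A \<noteq> B \<and> A \<in> up K F 1 {} \<and> B \<in> up K F 1 {} \<and> \<not> A \<le> G \<and> \<not> B \<le> G"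
    if "K \<in> up bot R k {}" for K
  proof -
    have K: "K \<in> L" "K \<le> R" "K \<le> J" "K \<le> J'" using that Rle by (auto simp: faces_iff)
    obtain A where A: "A \<in> up K J 1 {}" "\<not> A \<le> R" by (rule up_atom[OF K(1) L(2) RL K(3,2) nle(1)])
    obtain B where B: "B \<in> up K J' 1 {}" "\<not> B \<le> R" by (rule up_atom[OF K(1) L(3) RL K(4,2) nle(2)])
    have AJ: "A \<le> J" "B \<le> J'" using A B by (auto simp: up_def)
    have "\<not> A \<le> G" using A(2) AJ(1) R(1) by auto
    moreover have "\<not> B \<le> G" using B(2) AJ(2) R(2) by auto
    moreover have "A \<noteq> B" using AJ A JJ by auto
    moreover have "A \<in> up K F 1 {}" "B \<in> up K F 1 {}"
      using A B up_below[OF L(5)] up_below[OF L(6)] by blast+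
    ultimately show ?thesis by blast
  qed
  have "up bot R k {} \<subseteq> up bot G k {}" using up_below Rle by simp
  from extend_twice[OF FL L(1) lt this two]
  have "card (up bot G k {}) + card (up bot R k {}) \<le> card {A\<in>up bot F (Suc k) {}. \<not> A \<le> G \<and> rk (inf A G) = k}"
    by simp
  moreover have "e choose k \<le> card (up bot R k {})"
    using boolean_bound[OF bot_L RL bot_least, of k] R by (simp add: rk_bot)
  moreover have "card (up bot G (Suc k) {}) + card {A\<in>up bot F (Suc k) {}. \<not> A \<le> G \<and> rk (inf A G) = k}
      \<le> card (up bot F (Suc k) {})"
    using L(4) by (subst card_Un_disjoint[symmetric]; (intro card_mono)?) (auto simp: faces_iff finite_L)
  ultimately show ?thesis by linarith
qed

text \<open>A facet \<open>J\<close> meeting \<open>G\<close> in less than a ridge must be a two-fold pyramid over \<open>E = J \<inter> G\<close> with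
  apexes \<open>x\<close> and \<open>y\<close>. Each face \<open>K\<close> of \<open>E\<close> extends to both \<open>K * x\<close> and \<open>K * y\<close>, and to
  \<open>K * x * y\<close>.\<close>

lemma far_facet_bound:
  assumes FL: "F \<in> L" and rkF: "rk F = m + 3" and G: "G \<in> up bot F (m + 2) {}"
    and W: "{v\<in>verts F. \<not> v \<le> G} = {x, y}"
    and J: "J \<in> up bot F (m + 2) {}" "J \<noteq> G" "rk (inf J G) \<noteq> m + 1"
  shows "card (up bot G (Suc (Suc j)) {}) + card (up bot G (Suc j) {}) + ((m + 1) choose Suc j)
    \<le> card (up bot F (Suc (Suc j)) {})"
proof -
  have L: "G \<in> L" "J \<in> L" "G \<le> F" "J \<le> F" "rk G = m + 2" "rk J = m + 2"
    using G J by (auto simp: faces_iff)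
  have lt: "G < F" using L rkF by (cases "G = F") auto
  define E where "E = inf J G"
  have EL: "E \<in> L" using inf_L[OF L(2,1)] by (simp add: E_def)
  have Ele: "E \<le> J" "E \<le> G" by (auto simp: E_def)
  have Eiff: "K \<le> E \<longleftrightarrow> K \<le> J \<and> K \<le> G" for K by (simp add: E_def)
  have "\<not> J \<le> G" using rk_eq_imp_eq[OF L(2,1)] L J by auto
  then have "rk E < rk J" using rk_less[OF EL L(2)] by (simp add: E_def inf_less_iff)
  then have rkE: "rk E < m + 1" using J L by (simp add: E_def)
  have EJ: "E < J" using \<open>\<not> J \<le> G\<close> Ele by (metis Eiff le_less order_refl)
  have out: "v = x \<or> v = y" if "v \<in> verts F" "\<not> v \<le> G" for v using that W by blast
  have xy: "\<not> x \<le> E" "\<not> y \<le> E" using W by (auto simp: Eiff)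
  have vert: "\<exists>v\<in>verts K. \<not> v \<le> G" if "K \<in> L" "\<not> K \<le> G" for K
  proof -
    have "\<not> verts K \<subseteq> verts G" using verts_subset_iff[OF that(1) L(1)] that by simp
    then show ?thesis by (auto simp: verts_iff)
  qed
  have vert': "x \<le> K \<or> y \<le> K" if K: "K \<in> L" "K \<le> F" "\<not> K \<le> G" for K
  proof -
    obtain v where "v \<in> verts K" "\<not> v \<le> G" using vert K by blast
    then show ?thesis using out[of v] verts_mono[OF K(2)] by (auto simp: verts_iff)
  qed
  \<comment> \<open>A facet \<open>K\<close> of \<open>J\<close> over \<open>E\<close> missing one
    apex contains the other. A facet of \<open>K\<close> over \<open>E\<close> missing that one too
    has no vertex outside \<open>G\<close>, so it is \<open>E\<close>.\<close>
  have pyr: "rk K = Suc (rk E)" "q \<le> K"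
    if pq: "p = x \<and> q = y \<or> p = y \<and> q = x" and K: "K \<in> L" "E \<le> K" "K < J" "\<not> p \<le> K" "rk J = Suc (rk K)" for K p q
  proof -
    have KF: "K \<le> F" using K L by simp
    have "E < K" using K rkE L by (cases "E = K") auto
    have "\<not> K \<le> G"
    proof
      assume "K \<le> G"
      then have "K \<le> E" using K by (simp add: Eiff)
      then show False using \<open>E < K\<close> by simp
    qed
    then show "q \<le> K" using vert'[OF K(1) KF] pq K by auto
    have "\<not> q \<le> E" using pq xy by auto
    obtain K' where K': "K' \<in> L" "E \<le> K'" "K' < K" "rk K = Suc (rk K')" "\<not> q \<le> K'"
      by (rule facet_avoiding[OF EL K(1) \<open>E < K\<close> \<open>\<not> q \<le> E\<close>])
    have "\<not> p \<le> K'" using K' K by (metis less_imp_le order_trans)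
    then have "K' \<le> G" using vert'[OF K'(1)] K' KF pq by fastforce
    moreover have "K' \<le> J" using K' K by simp
    ultimately have "K' = E" using K' Eiff by (simp add: order.antisym)
    then show "rk K = Suc (rk E)" using K' by simp
  qed
  obtain J1 where J1: "J1 \<in> L" "E \<le> J1" "J1 < J" "rk J = Suc (rk J1)" "\<not> x \<le> J1"
    by (rule facet_avoiding[OF EL L(2) EJ xy(1)])
  obtain J2 where J2: "J2 \<in> L" "E \<le> J2" "J2 < J" "rk J = Suc (rk J2)" "\<not> y \<le> J2"
    by (rule facet_avoiding[OF EL L(2) EJ xy(2)])
  have rk1: "rk J1 = Suc (rk E)" and rkE': "rk E = m"
    using pyr(1)[of x y J1] J1 L by auto
  have nG: "\<not> J1 \<le> E" "\<not> J2 \<le> E"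
    using rk_mono[OF J1(1) EL] rk_mono[OF J2(1) EL] J1 J2 L rkE' by auto
  have J12F: "J1 \<le> F" "J2 \<le> F" using J1 J2 L by auto
  have two: "\<exists>A B. A \<noteq> B \<and> A \<in> up K F 1 {} \<and> B \<in> up K F 1 {} \<and> \<not> A \<le> G \<and> \<not> B \<le> G"
    if "K \<in> up bot E (Suc j) {}" for K
  proof -
    have K: "K \<in> L" "K \<le> E" "K \<le> J1" "K \<le> J2" using that J1 J2 by (auto simp: faces_iff)
    obtain A where A: "A \<in> up K J1 1 {}" "\<not> A \<le> E" by (rule up_atom[OF K(1) J1(1) EL K(3,2) nG(1)])
    obtain B where B: "B \<in> up K J2 1 {}" "\<not> B \<le> E" by (rule up_atom[OF K(1) J2(1) EL K(4,2) nG(2)])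
    have le: "A \<le> J1" "B \<le> J2" "A \<in> L" using A B by (auto simp: up_def)
    then have AJ: "A \<le> J" "B \<le> J" "A \<le> F" using J1 J2 L by auto
    have nA: "\<not> A \<le> G" "\<not> B \<le> G" using A B AJ Eiff by auto
    have "A \<noteq> B" using vert'[OF le(3) AJ(3) nA(1)] le J1(5) J2(5) order_trans by metis
    moreover have "A \<in> up K F 1 {}" "B \<in> up K F 1 {}"
      using A B up_below[OF J12F(1)] up_below[OF J12F(2)] by blast+
    ultimately show ?thesis using nA by blast
  qed
  \<comment> \<open>Faces outside \<open>G\<close> are sorted by the rank lost on meeting with
    \<open>G\<close>: one in \<open>?Y\<close>, two in \<open>?Z\<close>.\<close>
  let ?Z = "{A\<in>up bot F (Suc (Suc j)) {}. \<not> A \<le> G \<and> rk (inf A G) = j}"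
  let ?Y = "{A\<in>up bot F (Suc (Suc j)) {}. \<not> A \<le> G \<and> rk (inf A G) = Suc j}"
  have ex: "\<exists>B\<in>?Z. inf B G = K" if KE: "K \<in> up bot E j {}" for K
  proof -
    have K: "K \<in> L" "K \<le> E" "K \<le> J1" "K \<le> G" "rk K = j" using KE J1 Ele by (auto simp: faces_iff)
    have KG: "K \<in> up bot G j {}" using K by (simp add: faces_iff)
    obtain A where A: "A \<in> up K J1 1 {}" "\<not> A \<le> E" by (rule up_atom[OF K(1) J1(1) EL K(3,2) nG(1)])
    have A': "A \<in> L" "K \<le> A" "A \<le> J1" "rk A = Suc j" "A \<le> J" using A K J1 by (auto simp: up_def)
    have AG: "\<not> A \<le> G" using A A' Eiff by auto
    have AF: "A \<in> up K F 1 {}" using A up_below[OF J12F(1)] by blast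
    have iA: "inf A G = K" by (rule inf_extend[OF KG L(1) AF AG])
    have "\<not> J \<le> J1" using J1 by simp
    \<comment> \<open>\<open>B\<close> plays the part of \<open>K * x * y\<close>: its meet with
      \<open>G\<close> lies in \<open>E\<close>, hence in \<open>J1\<close>, hence in
      \<open>inf B J1 = A\<close>, and so in \<open>inf A G = K\<close>.\<close>
    obtain B where B: "B \<in> up A J 1 {}" "\<not> B \<le> J1" by (rule up_atom[OF A'(1) L(2) J1(1) A'(5,3) \<open>\<not> J \<le> J1\<close>])
    have B': "B \<in> L" "A \<le> B" "B \<le> J" "rk B = Suc (Suc j)" using B A' by (auto simp: up_def)
    have iB: "inf B J1 = A" by (rule inf_atom[OF A'(1) J1(1) A'(3) B])
    have "inf B G \<le> E" using B' by (simp add: Eiff le_infI1)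
    then have "inf B G \<le> J1" using J1 by simp
    then have "inf B G \<le> inf B J1" by simp
    then have "inf B G \<le> A" using iB by simp
    then have "inf B G \<le> inf A G" by simp
    then have 1: "inf B G \<le> K" using iA by simp
    have "K \<le> B" using A' B' by simp
    then have "K \<le> inf B G" using K by simp
    with 1 have iK: "inf B G = K" by (rule order.antisym)
    have "\<not> B \<le> G" using AG B' order_trans by blast
    moreover have "B \<le> F" using B' L by simp
    ultimately show ?thesis using B' iK K by (intro bexI[of _ B]) (auto simp: faces_iff)
  qed
  have "up bot E j {} \<subseteq> (\<lambda>B. inf B G) ` ?Z" using ex by blast
  then have "card (up bot E j {}) \<le> card ?Z" by (intro surj_card_le) auto
  moreover have "m choose j \<le> card (up bot E j {})"
    using boolean_bound[OF bot_L EL bot_least, of j] rkE' by (simp add: rk_bot)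
  moreover have "m choose Suc j \<le> card (up bot E (Suc j) {})"
    using boolean_bound[OF bot_L EL bot_least, of "Suc j"] rkE' by (simp add: rk_bot)
  moreover have "card (up bot G (Suc j) {}) + card (up bot E (Suc j) {}) \<le> card ?Y"
    by (rule extend_twice[OF FL L(1) lt up_below[OF Ele(2)] two])
  moreover have "card (up bot G (Suc (Suc j)) {}) + card ?Y + card ?Z \<le> card (up bot F (Suc (Suc j)) {})"
  proof -
    have "card (up bot G (Suc (Suc j)) {}) + card ?Y + card ?Z = card ((up bot G (Suc (Suc j)) {} \<union> ?Y) \<union> ?Z)"
      by (subst card_Un_disjoint; (subst card_Un_disjoint)?) (auto simp: faces_iff finite_L)
    also have "\<dots> \<le> card (up bot F (Suc (Suc j)) {})"
      using L(3) by (intro card_mono) (auto simp: faces_iff)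
    finally show ?thesis .
  qed
  ultimately show ?thesis by simp
qed

section \<open>The induction for many facets\<close>

text \<open>The range starts at \<open>s = 2\<close> because the induction may pass from
  \<open>s\<close> to \<open>s - 1\<close>. Subtracted terms stand on the right.\<close>

theorem many_facets_bound:
  assumes "F \<in> L" "rk F = Suc d" "card (verts F) = d + s" "2 \<le> s" "s \<le> d"
    and "d + 3 \<le> card (up bot F d {})"
  shows "(Suc d choose Suc (Suc j)) + (d choose Suc (Suc j)) + ((d - 1) choose Suc j)
    \<le> card (up bot F (Suc (Suc j)) {}) + ((d + 1 - s) choose Suc (Suc j)) + ((d + 1 - s) choose Suc j)"
  using assms
proof (induction d arbitrary: F s)
  case (Suc e)
  note FL = Suc.prems(1) and rkF = Suc.prems(2) and cF = Suc.prems(3)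
  consider "s = 2" | "3 \<le> s" "\<forall>G\<in>up bot F (Suc e) {}. card (verts G) = Suc e \<or> Suc (card (verts G)) = card (verts F)"
    | G where "3 \<le> s" "G \<in> up bot F (Suc e) {}" "card (verts G) \<noteq> Suc e" "Suc (card (verts G)) \<noteq> card (verts F)"
    using Suc.prems(4) by fastforce
  then show ?case
  proof cases
    case 1
    \<comment> \<open>For \<open>s = 2\<close> the last terms on both sides cancel.\<close>
    then show ?thesis using xue_bound[OF FL rkF cF, of "Suc j"] Suc.prems(5) by simp
  next
    case 2
    then show ?thesis using pyramidal_bound[OF FL rkF _ cF] by blast
  next
    case 3
    note G = 3(2)
    have G': "G \<in> L" "G \<le> F" "rk G = Suc e" using G by (auto simp: faces_iff)
    obtain m where m: "e = Suc m" using 3(1) Suc.prems(5) by (cases e) auto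
    define W where "W = {v\<in>verts F. \<not> v \<le> G}"
    define r where "r = card W"
    have split: "Suc e + s = card (verts G) + r"
      using facet_split[OF FL G'(1,2)] cF by (simp add: W_def r_def)
    have cG: "Suc e + 1 \<le> card (verts G)" using verts_card_ge[OF G'(1)] G'(3) 3(3) by simp
    have "\<not> F \<le> G" using rk_mono[OF FL G'(1)] G' rkF by auto
    then have "verts G \<subset> verts F" using verts_subset_iff[OF FL G'(1)] verts_mono[OF G'(2)] by blast
    then have "card (verts G) < card (verts F)" by (intro psubset_card_mono) auto
    then have r2: "2 \<le> r" using split 3(4) cF by linarith
    have rkF': "rk F = m + 3" using rkF m by simp
    have WV: "W \<subseteq> verts F" by (auto simp: W_def)
    \<comment> \<open>Without a non-simple vertex or a nonadjacent pair in \<open>W\<close>,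
      \<open>simple_clique_facets\<close> would allow at most \<open>Suc e + 2\<close>
      facets.\<close>
    have gain: "((m + 3) choose Suc (Suc j)) + (m choose j) \<le> touch F (Suc (Suc j)) W + ((m + 3 - r) choose Suc (Suc j))"
    proof -
      have "(\<exists>v\<in>W. m + 2 < card (edges v F)) \<or> (\<exists>v\<in>W. \<exists>w\<in>W. v \<noteq> w \<and> (\<forall>A\<in>edges w F. \<not> v \<le> A))"
      proof (rule ccontr)
        assume no: "\<not> ?thesis"
        have "card (up bot F (Suc e) {}) \<le> Suc e + 2"
        proof (rule simple_clique_facets[OF FL rkF G W_def])
          show "card (edges v F) \<le> Suc e" if "v \<in> W" for v using no that m by (auto simp: not_less)
          show "\<exists>A\<in>edges w F. v \<le> A" if "v \<in> W" "w \<in> W" "v \<noteq> w" for v w using no that by blast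
        qed
        then show False using Suc.prems(6) by simp
      qed
      then show ?thesis unfolding r_def by (rule touch_gain[OF FL rkF' WV])
    qed
    have fG: "card (up bot G (Suc (Suc j)) {}) + touch F (Suc (Suc j)) W \<le> card (up bot F (Suc (Suc j)) {})"
      using touch_facet[OF G'(2), of W] by (simp add: W_def)
    show ?thesis
    proof (cases "r = 2")
      case False
      define s' where "s' = card (verts G) - e"
      have s': "card (verts G) = e + s'" "2 \<le> s'" using cG by (auto simp: s'_def)
      have "(Suc e choose Suc (Suc j)) + (e choose Suc (Suc j)) \<le> card (up bot G (Suc (Suc j)) {}) + ((e + 1 - s') choose Suc (Suc j))"
        using s' split r2 False Suc.prems(5) by (intro xue_bound[OF G'(1,3)]) auto
      \<comment> \<open>Here \<open>s' + r = s + 1\<close>. What convexity leaves over is \<open>(m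
        + 1 choose Suc (Suc j)) - (m choose Suc (Suc j)) = (m choose Suc j)\<close>, and the gain
        \<open>(m choose j)\<close> completes it to the required
        \<open>(m + 1 choose Suc j)\<close>.\<close>
      moreover have "((m + 2 - s') choose Suc (Suc j)) + ((m + 3 - r) choose Suc (Suc j))
          \<le> (m choose Suc (Suc j)) + ((m + 4 - s) choose Suc (Suc j))"
        using split s' r2 False m Suc.prems(5) by (intro binomial_convex) auto
      moreover have "(m + 4 - s) choose Suc (Suc j) = ((m + 3 - s) choose Suc (Suc j)) + ((m + 3 - s) choose Suc j)"
      proof -
        have "m + 4 - s = Suc (m + 3 - s)" using Suc.prems(5) m by simp
        then show ?thesis by simp
      qed
      ultimately show ?thesis using gain fG m by (simp add: numeral_3_eq_3)
    next
      case True
      have cG': "card (verts G) = e + (s - 1)" using split True 3(1) by simp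
      obtain x y where W: "W = {x, y}" using True r_def card_2_iff by metis
      define Js where "Js = up bot F (Suc e) {} - {G}"
      show ?thesis
      \<comment> \<open>If the other facets meet \<open>G\<close> in distinct ridges,
        \<open>G\<close> has at least \<open>e + 3\<close> facets and induction applies with
        \<open>s - 1\<close>.\<close>
      proof (cases "(\<forall>J\<in>Js. rk (inf J G) = e) \<and> inj_on (\<lambda>J. inf J G) Js")
        case True
        have "(\<lambda>J. inf J G) ` Js \<subseteq> up bot G e {}"
          using True inf_L G' by (auto simp: Js_def faces_iff)
        then have "card Js \<le> card (up bot G e {})"
          using True by (intro card_inj_on_le) auto
        moreover have "card Js = card (up bot F (Suc e) {}) - 1" using G by (simp add: Js_def)
        ultimately have "e + 3 \<le> card (up bot G e {})" using Suc.prems(6) by simp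
        then have "(Suc e choose Suc (Suc j)) + (e choose Suc (Suc j)) + ((e - 1) choose Suc j)
            \<le> card (up bot G (Suc (Suc j)) {}) + ((e + 1 - (s - 1)) choose Suc (Suc j)) + ((e + 1 - (s - 1)) choose Suc j)"
          using 3(1) Suc.prems(5) by (intro Suc.IH[OF G'(1,3) cG']) auto
        then have "(Suc e choose Suc (Suc j)) + (e choose Suc (Suc j)) + (m choose Suc j)
            \<le> card (up bot G (Suc (Suc j)) {}) + ((m + 3 - s) choose Suc (Suc j)) + ((m + 3 - s) choose Suc j)"
          using m 3(1) by (simp add: numeral_3_eq_3)
        then show ?thesis using gain fG m \<open>r = 2\<close> by (simp add: numeral_3_eq_3 numeral_2_eq_2)
      next
        case False
        have extra: "card (up bot G (Suc (Suc j)) {}) + card (up bot G (Suc j) {}) + (e choose Suc j)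
            \<le> card (up bot F (Suc (Suc j)) {})"
        proof (cases "\<forall>J\<in>Js. rk (inf J G) = e")
          case True
          then obtain J J' where J: "J \<in> Js" "J' \<in> Js" "J \<noteq> J'" "inf J G = inf J' G"
            using False unfolding inj_on_def by blast
          show ?thesis
            by (rule shared_ridge_bound[OF FL rkF G _ _ J(3) refl J(4)[symmetric]])
              (use J True in \<open>auto simp: Js_def\<close>)
        next
          case False
          then obtain J where J: "J \<in> Js" "rk (inf J G) \<noteq> e" by blast
          have GF: "G \<in> up bot F (m + 2) {}" "J \<in> up bot F (m + 2) {}" "J \<noteq> G" "rk (inf J G) \<noteq> m + 1"
            using G J m by (auto simp: Js_def)
          show ?thesis
            using far_facet_bound[OF FL rkF' GF(1) W[unfolded W_def] GF(2-4), of j] m by simp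
        qed
        \<comment> \<open>By Pascal's rule, two consecutive instances for \<open>G\<close> add up to
          the bound of \<open>xue_bound\<close> type for \<open>F\<close>; \<open>extra\<close>
          supplies the missing \<open>(e choose Suc j)\<close>.\<close>
        have "(Suc e choose Suc i) + (e choose Suc i) \<le> card (up bot G (Suc i) {}) + ((e + 1 - (s - 1)) choose Suc i)" for i
          using 3(1) Suc.prems(5) by (intro xue_bound[OF G'(1,3) cG']) auto
        from this[of "Suc j"] this[of j]
        have "(Suc e choose Suc (Suc j)) + (e choose Suc (Suc j)) + (Suc e choose Suc j) + (e choose Suc j)
          \<le> card (up bot G (Suc (Suc j)) {}) + card (up bot G (Suc j) {})
            + ((m + 3 - s) choose Suc (Suc j)) + ((m + 3 - s) choose Suc j)"
          using m 3(1) by (simp add: numeral_3_eq_3)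
        then show ?thesis using extra m by (simp add: numeral_3_eq_3)
      qed
    qed
  qed
qed simp

end

section \<open>The face lattice of a polytope\<close>

definition face_rank :: "'a::euclidean_space set \<Rightarrow> nat" where
  "face_rank F = nat (aff_dim F + 1)"

lemma face_rank_eq_iff: "face_rank F = Suc n \<longleftrightarrow> aff_dim F = int n"
  unfolding face_rank_def using aff_dim_geq[of F] by linarith

text \<open>A nonempty proper face is the intersection of the facets containing it, so one of them
  omits a chosen point of \<open>Y - E\<close>. The empty face is first enlarged to a vertex other
  than that point.\<close>

lemma facet_avoiding_face:
  fixes P :: "'a::euclidean_space set"
  assumes P: "polytope P" and E: "E face_of P" "E \<subset> P" and Y: "\<not> Y \<subseteq> E"
  shows "\<exists>G. G face_of P \<and> aff_dim G = aff_dim P - 1 \<and> E \<subseteq> G \<and> \<not> Y \<subseteq> G"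
proof -
  have ph: "polyhedron P" using P by (rule polytope_imp_polyhedron)
  obtain y where y: "y \<in> Y" "y \<notin> E" using Y by blast
  have facet: ?thesis if E': "E' face_of P" "E' \<noteq> {}" "E' \<noteq> P" "y \<notin> E'" "E \<subseteq> E'" for E'
  proof -
    have "y \<notin> \<Inter>{F. F facet_of P \<and> E' \<subseteq> F}"
      using face_of_polyhedron[OF ph E'(1-3)] E'(4) by simp
    then obtain G where G: "G facet_of P" "E' \<subseteq> G" "y \<notin> G" by auto
    have "E \<subseteq> G" "\<not> Y \<subseteq> G" using E'(5) y G by auto
    then show ?thesis using G(1) unfolding facet_of_def by (intro exI[of _ G]) simp
  qed
  show ?thesis
  proof (cases "E = {}")
    case False
    then show ?thesis using facet[OF E(1) False] E(2) y by simp
  next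
    case True
    have "P \<noteq> {}" using E True by blast
    show ?thesis
    \<comment> \<open>A single point has no second vertex; there the empty face, of dimension -1, is
      the required facet.\<close>
    proof (cases "\<exists>p. P = {p}")
      case True
      then have "aff_dim {} = aff_dim P - 1" by auto
      then show ?thesis using y \<open>E = {}\<close> by (intro exI[of _ "{}"]) auto
    next
      case False
      have "\<not> {v. v extreme_point_of P} \<subseteq> {y}"
      proof
        assume "{v. v extreme_point_of P} \<subseteq> {y}"
        from hull_mono[OF this, of convex] have "P \<subseteq> convex hull {y}"
          using Krein_Milman_Minkowski[OF polytope_imp_compact[OF P] polytope_imp_convex[OF P]]
          by simp
        then show False using False \<open>P \<noteq> {}\<close> by (auto simp: subset_singleton_iff)
      qed
      then obtain p where "p extreme_point_of P" "p \<noteq> y" by blast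
      moreover have "{p} \<noteq> P" using False by blast
      ultimately show ?thesis using \<open>E = {}\<close> by (intro facet[of "{p}"]) (auto simp: face_of_singleton)
    qed
  qed
qed

lemma face_lattice_polytope:
  fixes P :: "'a::euclidean_space set"
  assumes P: "polytope P"
  shows "face_lattice {F. F face_of P} face_rank"
proof
  show "finite {F. F face_of P}" by (rule finite_polytope_faces[OF P])
  show "bot \<in> {F. F face_of P}" by simp
  show "face_rank (bot :: 'a set) = 0" by (simp add: face_rank_def)
  show "inf A B \<in> {F. F face_of P}" if "A \<in> {F. F face_of P}" "B \<in> {F. F face_of P}" for A B
    using that face_of_Int by auto
  show "face_rank A < face_rank B"
    if "A \<in> {F. F face_of P}" "B \<in> {F. F face_of P}" "A < B" for A B
  proof -
    have "A face_of B" using that by (auto simp: face_of_face)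
    then have "aff_dim A < aff_dim B"
      using that face_of_imp_convex by (intro face_of_aff_dim_lt) auto
    then show ?thesis using aff_dim_geq[of A] by (simp add: face_rank_def)
  qed
  show "\<exists>G\<in>{F. F face_of P}. E \<le> G \<and> G < F \<and> face_rank F = Suc (face_rank G) \<and> \<not> Y \<le> G"
    if "E \<in> {F. F face_of P}" "F \<in> {F. F face_of P}" "E < F" "\<not> Y \<le> E" for E F Y
  proof -
    have F: "F face_of P" "polytope F" using that face_of_polytope_polytope[OF P] by auto
    have "E face_of F" using that by (auto simp: face_of_face)
    from facet_avoiding_face[OF F(2) this that(3,4)]
    obtain G where G: "G face_of F" "aff_dim G = aff_dim F - 1" "E \<subseteq> G" "\<not> Y \<subseteq> G"
      by (elim exE conjE)
    have "G \<subset> F"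
    proof
      show "G \<subseteq> F" using G(1) by (rule face_of_imp_subset)
      show "G \<noteq> F" using G(2) by auto
    qed
    moreover have "face_rank F = Suc (face_rank G)"
      using G aff_dim_geq[of G] by (simp add: face_rank_def)
    moreover have "G face_of P" using G(1) F(1) by (rule face_of_trans)
    ultimately show ?thesis using G(3,4) by (intro bexI[of _ G]) simp_all
  qed
  show "card {v \<in> {F. F face_of P}. v \<le> A \<and> face_rank v = 1} \<le> 2"
    if "A \<in> {F. F face_of P}" "face_rank A = 2" for A
  proof -
    have A: "A face_of P" "polytope A" using that face_of_polytope_polytope[OF P] by auto
    have "aff_dim A = 1" using that(2) face_rank_eq_iff[of A 1] by simp
    then have "A \<noteq> {}" "collinear A" by (auto simp: collinear_aff_dim)
    then obtain a b where ab: "A = closed_segment a b"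
      using compact_convex_collinear_segment[of A] A(2) polytope_imp_compact polytope_imp_convex by blast
    have "{v \<in> {F. F face_of P}. v \<le> A \<and> face_rank v = 1} \<subseteq> {{a}, {b}}"
    proof
      fix v assume v: "v \<in> {v \<in> {F. F face_of P}. v \<le> A \<and> face_rank v = 1}"
      then have "v face_of A" using A by (auto simp: face_of_face)
      moreover obtain x where x: "v = {x}"
        using v face_rank_eq_iff[of v 0] by (auto simp: aff_dim_eq_0)
      ultimately have "x extreme_point_of closed_segment a b" by (simp add: face_of_singleton ab)
      then show "v \<in> {{a}, {b}}" using x by (auto simp: extreme_point_of_segment)
    qed
    then have "card {v \<in> {F. F face_of P}. v \<le> A \<and> face_rank v = 1} \<le> card {{a}, {b}}"
      by (intro card_mono) auto
    also have "\<dots> \<le> 2" by (simp add: card_insert_if)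
    finally show ?thesis .
  qed
qed

theorem theorem3p6:
  fixes P :: "'a::euclidean_space set" and d s k :: nat
  assumes "3 \<le> d" and "3 \<le> s" and "s \<le> d"
    and "polytope P" and "aff_dim P = int d"
    and "card {v. v extreme_point_of P} = d + s"
    and "card {F. F facet_of P} \<ge> d + 3"
    and "k \<in> {1..d - 2}"
  shows "int (num_faces k P) \<ge> zeta k (d + s) d \<and>
    zeta k (d + s) d =
      int ((d + 1) choose (k + 1)) + int (d choose (k + 1))
        - int ((d + 1 - s) choose (k + 1))
      + int ((d - 1) choose k) - int ((d + 1 - s) choose k)"
proof
  interpret face_lattice "{F. F face_of P}" face_rank
    by (rule face_lattice_polytope[OF assms(4)])
  have PL: "P \<in> {F. F face_of P}"
    using assms(4) by (simp add: face_of_refl polytope_imp_convex)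
  have rkP: "face_rank P = Suc d" using assms(5) by (simp add: face_rank_eq_iff)
  have rank_face: "F \<in> up bot P (Suc n) {} \<longleftrightarrow> F face_of P \<and> aff_dim F = int n" for F n
    by (auto simp: faces_iff face_rank_eq_iff dest: face_of_imp_subset)
  have "verts P = (\<lambda>v. {v}) ` {v. v extreme_point_of P}"
  proof (rule set_eqI)
    fix v
    have "v \<in> verts P \<longleftrightarrow> v face_of P \<and> (\<exists>x. v = {x})"
      using rank_face[of v 0] by (simp add: verts_def aff_dim_eq_0)
    also have "\<dots> \<longleftrightarrow> v \<in> (\<lambda>v. {v}) ` {v. v extreme_point_of P}"
      by (auto simp: face_of_singleton)
    finally show "v \<in> verts P \<longleftrightarrow> v \<in> (\<lambda>v. {v}) ` {v. v extreme_point_of P}" .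
  qed
  then have vP: "card (verts P) = d + s" using assms(6) by (simp add: card_image)
  obtain e where e: "d = Suc e" using assms(1) by (cases d) auto
  have "up bot P d {} = {F. F facet_of P}"
    using assms(5) unfolding e set_eq_iff rank_face facet_of_def by auto
  then have fP: "d + 3 \<le> card (up bot P d {})" using assms(7) by simp
  have faces: "up bot P (Suc k) {} = {F. F face_of P \<and> aff_dim F = int k}"
    unfolding set_eq_iff rank_face by simp
  \<comment> \<open>Faces of dimension \<open>k\<close> have rank
    \<open>Suc k = Suc (Suc j)\<close>, the form in which the bound is stated.\<close>
  obtain j where j: "k = Suc j" using assms(8) by (cases k) auto
  have "(Suc d choose Suc k) + (d choose Suc k) + ((d - 1) choose k)
    \<le> num_faces k P + ((d + 1 - s) choose Suc k) + ((d + 1 - s) choose k)"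
    using many_facets_bound[OF PL rkP vP _ assms(3) fP, of j] assms(2) faces j
    by (simp add: num_faces_def)
  moreover show z: "zeta k (d + s) d =
      int ((d + 1) choose (k + 1)) + int (d choose (k + 1))
        - int ((d + 1 - s) choose (k + 1))
      + int ((d - 1) choose k) - int ((d + 1 - s) choose k)"
  proof -
    have "2 * d + 1 - (d + s) = d + 1 - s" by simp
    then show ?thesis unfolding zeta_def by simp
  qed
  ultimately show "int (num_faces k P) \<ge> zeta k (d + s) d" by simp
qed

end
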